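(* Let $d\ge 1$ and, for each integer $L\ge 0$, let $\mathcal{Z}(L)=\{z_{L1},\dots,z_{L,\pi_L}\}\subset\mathbb{S}^d$ be a set of Fekete points of degree $L$ for $\mathbb{S}^d$. Then the normalized counting measures $\mu_L=\frac{1}{\pi_L}\sum_{j=1}^{\pi_L}\delta_{z_{Lj}}$ converge vaguely to the normalized Lebesgue measure on $\mathbb{S}^d$ as $L\to\infty$; that is, for every $f\in\mathcal{C}(\mathbb{S}^d)$, $$\lim_{L\to\infty}\frac{1}{\pi_L}\sum_{j=1}^{\pi_L}f(z_{Lj})=\frac{1}{\sigma(\mathbb{S}^d)}\int_{\mathbb{S}^d}f(z)\,d\sigma(z).$$
   Context: $\mathbb{S}^d$ is the unit sphere in $\mathbb{R}^{d+1}$ and $\sigma$ is its Lebesgue surface measure. $\Pi_L$ is the space of spherical harmonics of degree not exceeding $L$ on $\mathbb{S}^d$ (equivalently, the restrictions to $\mathbb{S}^d$ of polynomials in $d+1$ variables of degree at most $L$), and $\pi_L=\dim\Pi_L=\frac{d+2L}{d}\binom{d+L-1}{L}$. Fekete points: let $\{Q_1^L,\dots,Q_{\pi_L}^L\}$ be any basis of $\Pi_L$. A set of Fekete points of degree $L$ for $\mathbb{S}^d$ is a set of points $\{z_{L1},\dots,z_{L,\pi_L}\}\subset\mathbb{S}^d$ such that $(z_{L1},\dots,z_{L,\pi_L})$ maximizes $|\Delta(x_1,\dots,x_{\pi_L})|=|\det(Q_i^L(x_j))_{i,j}|$ over all $(x_1,\dots,x_{\pi_L})\in(\mathbb{S}^d)^{\pi_L}$.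 (This does not depend on the choice of basis.) *)

theory Defs
  imports
    "HOL-Analysis.Analysis"
    "HOL-Library.Function_Algebras"
    "Jordan_Normal_Form.Determinant"
begin

(* Real-valued functions form a real vector space, which makes the library's span,
   independent and dim available for them.  (Library only provides ab_group_add.) *)
instantiation "fun" :: (type, real_vector) real_vector
begin

definition scaleR_fun_def: "scaleR c f = (\<lambda>x. scaleR c (f x))"

instance
  by standard (auto simp: scaleR_fun_def plus_fun_def fun_eq_iff scaleR_add_right scaleR_add_left)

end

definition monomial_fun :: "('n \<Rightarrow> nat) \<Rightarrow> real ^ 'n::finite \<Rightarrow> real" where
  "monomial_fun \<alpha> = (\<lambda>x. \<Prod>i\<in>UNIV. vec_nth x i ^ \<alpha> i)"

definition polys_upto :: "nat \<Rightarrow> (real ^ 'n::finite \<Rightarrow> real) set" where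
  "polys_upto L = span {monomial_fun \<alpha> |\<alpha>. (\<Sum>i\<in>UNIV. \<alpha> i) \<le> L}"

(* A function on the sphere is represented by its extension by zero to the whole space,
   so that equality of representatives is equality on the sphere. *)
definition on_sphere :: "(real ^ 'n::finite \<Rightarrow> real) \<Rightarrow> real ^ 'n \<Rightarrow> real" where
  "on_sphere p = (\<lambda>x. if x \<in> sphere 0 1 then p x else 0)"

definition sph_space :: "nat \<Rightarrow> (real ^ 'n::finite \<Rightarrow> real) set" where
  "sph_space L = on_sphere ` polys_upto L"

(* The type argument fixes the ambient space, hence the sphere. *)
definition sph_dim :: "'n::finite itself \<Rightarrow> nat \<Rightarrow> nat" where
  "sph_dim _ L = dim (sph_space L :: (real ^ 'n \<Rightarrow> real) set)"

definition sph_basis :: "nat \<Rightarrow> (nat \<Rightarrow> real ^ 'n::finite \<Rightarrow> real) \<Rightarrow> bool" where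
  "sph_basis L Q \<longleftrightarrow>
     inj_on Q {..<sph_dim TYPE('n) L} \<and>
     independent (Q ` {..<sph_dim TYPE('n) L}) \<and>
     span (Q ` {..<sph_dim TYPE('n) L}) = sph_space L"

definition vandermonde ::
    "nat \<Rightarrow> (nat \<Rightarrow> real ^ 'n::finite \<Rightarrow> real) \<Rightarrow> (nat \<Rightarrow> real ^ 'n) \<Rightarrow> real" where
  "vandermonde L Q x =
     Determinant.det (Matrix.mat (sph_dim TYPE('n) L) (sph_dim TYPE('n) L) (\<lambda>(i, j). Q i (x j)))"

(* Changing the basis multiplies the determinant by a nonzero constant, so being a maximizer
   for one basis is the same as being a maximizer for every basis. *)
definition fekete_points :: "nat \<Rightarrow> (nat \<Rightarrow> real ^ 'n::finite) \<Rightarrow> bool" where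
  "fekete_points L z \<longleftrightarrow>
     (\<forall>j<sph_dim TYPE('n) L. z j \<in> sphere 0 1) \<and>
     (\<exists>Q. sph_basis L Q \<and>
       (\<forall>x. (\<forall>j<sph_dim TYPE('n) L. x j \<in> sphere 0 1) \<longrightarrow>
          \<bar>vandermonde L Q x\<bar> \<le> \<bar>vandermonde L Q z\<bar>))"

(* Surface measure from polar coordinates: with n the dimension of the ambient space, the measure
   of A is n times the Lebesgue measure of the cone {r *\<^sub>R a | 0 < r \<le> 1, a \<in> A}. *)
definition surface_measure :: "(real ^ 'n::finite) measure" where
  "surface_measure =
     scale_measure (of_nat CARD('n))
       (distr (restrict_space lborel (cball 0 1 - {0})) (restrict_space borel (sphere 0 1))
          (\<lambda>x. x /\<^sub>R norm x))"

end

theory Submission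
  imports Defs
begin

text \<open>
  Write \<open>\<Pi>\<^sub>L\<close> for the polynomials of degree at most \<open>L\<close> on the sphere, \<open>\<pi>\<^sub>L\<close> for its dimension and \<open>E\<close> for
  the mean over the sphere. Let \<open>z\<^sub>j\<close> be Fekete points of degree \<open>M = N + m\<close>, and let \<open>f\<close> be a polynomial of degree
  \<open>k\<close> with \<open>0 \<le> f \<le> C\<close> on the sphere. The core of the proof is the inequality

  \<open>\<Sum>\<^sub>j f(z\<^sub>j) \<ge> \<pi>\<^sub>N\<^sub>-\<^sub>k E f - C \<pi>\<^sub>M sqrt ((\<pi>\<^sub>N - \<pi>\<^sub>N\<^sub>-\<^sub>k) / \<pi>\<^sub>m)\<close>   (\<open>fekete_sum_lower\<close>),

  obtained by computing one trace twice. On \<open>\<Pi>\<^sub>N\<close> consider the two inner products \<open>E (g h)\<close> and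
  \<open>\<Sum>\<^sub>j g(z\<^sub>j) h(z\<^sub>j)\<close>, and let \<open>T\<close> be multiplication by \<open>f\<close> followed by the projection to \<open>\<Pi>\<^sub>N\<close> that is orthogonal for the
  second one. In a basis orthonormal for the second product the trace of \<open>T\<close> is \<open>\<Sum>\<^sub>j f(z\<^sub>j) \<kappa>(z\<^sub>j)\<close> with weights
  \<open>\<kappa>(z\<^sub>j) \<le> 1\<close>, hence at most \<open>\<Sum>\<^sub>j f(z\<^sub>j)\<close>. In a basis orthonormal for the first product, the elements of degree at most
  \<open>N - k\<close> contribute exactly \<open>\<pi>\<^sub>N\<^sub>-\<^sub>k E f\<close>: there \<open>T\<close> is plain multiplication, and the squares of the basis
  functions add up to the constant \<open>\<pi>\<^sub>N\<^sub>-\<^sub>k\<close> by rotation invariance (\<open>kernel_diagonal\<close>).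

  The Fekete property controls the other \<open>\<pi>\<^sub>N - \<pi>\<^sub>N\<^sub>-\<^sub>k\<close> basis functions. It says that the Lagrange functions
  \<open>l\<^sub>j\<close> are bounded by 1 (\<open>fekete_lagrange\<close>). If \<open>p\<^sub>j\<close> is the reproducing kernel of \<open>\<Pi>\<^sub>m\<close> at \<open>z\<^sub>j\<close>, normalised to
  \<open>p\<^sub>j(z\<^sub>j) = 1\<close>, then \<open>g = \<Sum>\<^sub>j g(z\<^sub>j) p\<^sub>j l\<^sub>j\<close> for \<open>g\<close> in \<open>\<Pi>\<^sub>N\<close>, and \<open>E ((p\<^sub>j l\<^sub>j)\<^sup>2) \<le> E (p\<^sub>j\<^sup>2) = 1 / \<pi>\<^sub>m\<close>. The Cauchy-Schwarz and Bessel
  inequalities then give the error term.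

  Since \<open>\<pi>\<^sub>L\<close> grows at least like \<open>L\<^sup>d\<close> and its increments at most like \<open>L\<^sup>d\<^sup>-\<^sup>1\<close> (\<open>sph_dim_growth\<close>, \<open>sph_dim_add\<close>), the choice
  \<open>m = M div q\<close> with \<open>M\<close> and then \<open>q\<close> tending to infinity shows that the limit inferior of the averages of \<open>f\<close> is at
  least \<open>E f\<close>. Adding constants removes the sign condition, the same for \<open>- f\<close> gives the limit, and
  the Stone-Weierstrass theorem passes to continuous functions.
\<close>

section \<open>Orthonormal systems for a definite form\<close>

lemma sum_fun_apply: "(\<Sum>i\<in>I. h i) x = (\<Sum>i\<in>I. (h i x :: real))"
  by (induction I rule: infinite_finite_induct) auto

text \<open>The form only has to behave well on a subspace, because the mean of a product over the sphere
  is bilinear only for integrable functions, and the sum over the Fekete points is definite only on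
  polynomials of bounded degree.\<close>

locale inner_form =
  fixes V :: "'a::real_vector set" and ip :: "'a \<Rightarrow> 'a \<Rightarrow> real"
  assumes subspace_V: "subspace V"
    and ip_add: "x \<in> V \<Longrightarrow> y \<in> V \<Longrightarrow> z \<in> V \<Longrightarrow> ip (x + y) z = ip x z + ip y z"
    and ip_scale: "x \<in> V \<Longrightarrow> z \<in> V \<Longrightarrow> ip (c *\<^sub>R x) z = c * ip x z"
    and ip_sym: "x \<in> V \<Longrightarrow> y \<in> V \<Longrightarrow> ip x y = ip y x"
    and ip_nonneg: "x \<in> V \<Longrightarrow> 0 \<le> ip x x"
    and ip_definite: "x \<in> V \<Longrightarrow> ip x x = 0 \<Longrightarrow> x = 0"
begin

lemmas V_closed = subspace_add[OF subspace_V] subspace_diff[OF subspace_V]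
  subspace_scale[OF subspace_V] subspace_0[OF subspace_V] subspace_sum[OF subspace_V]

lemma span_in_V: "B \<subseteq> V \<Longrightarrow> x \<in> span B \<Longrightarrow> x \<in> V"
  using span_minimal[OF _ subspace_V] by blast

lemma ip_zero_left: "z \<in> V \<Longrightarrow> ip 0 z = 0"
  using ip_scale[of 0 z 0] V_closed by simp

lemma ip_sum_left:
  assumes "\<And>i. i \<in> I \<Longrightarrow> h i \<in> V" "z \<in> V"
  shows "ip (\<Sum>i\<in>I. c i *\<^sub>R h i) z = (\<Sum>i\<in>I. c i * ip (h i) z)"
  using assms
proof (induction I rule: infinite_finite_induct)
  case (insert i I)
  have "ip (c i *\<^sub>R h i + (\<Sum>i\<in>I. c i *\<^sub>R h i)) z = ip (c i *\<^sub>R h i) z + ip (\<Sum>i\<in>I. c i *\<^sub>R h i) z"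
    using insert by (intro ip_add V_closed) auto
  then show ?case using insert ip_scale by simp
qed (auto simp: ip_zero_left)

lemma ip_sum_right:
  assumes "\<And>i. i \<in> I \<Longrightarrow> h i \<in> V" "z \<in> V"
  shows "ip z (\<Sum>i\<in>I. c i *\<^sub>R h i) = (\<Sum>i\<in>I. c i * ip z (h i))"
proof -
  have "ip z (\<Sum>i\<in>I. c i *\<^sub>R h i) = ip (\<Sum>i\<in>I. c i *\<^sub>R h i) z"
    using assms by (intro ip_sym V_closed) auto
  also have "\<dots> = (\<Sum>i\<in>I. c i * ip z (h i))"
    using assms ip_sym by (auto simp: ip_sum_left intro!: sum.cong)
  finally show ?thesis .
qed

lemma ip_diff_left:
  assumes "x \<in> V" "y \<in> V" "z \<in> V"
  shows "ip (x - y) z = ip x z - ip y z"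
  using ip_add[of "x - y" y z] assms V_closed by auto

definition orthonormal :: "'a set \<Rightarrow> bool" where
  "orthonormal U \<longleftrightarrow> finite U \<and> U \<subseteq> V \<and> (\<forall>u\<in>U. \<forall>v\<in>U. ip u v = (if u = v then 1 else 0))"

lemma orthonormal_subset: "orthonormal U \<Longrightarrow> T \<subseteq> U \<Longrightarrow> orthonormal T"
  unfolding orthonormal_def by (meson finite_subset subset_iff)

lemma ip_orthonormal_sum:
  assumes U: "orthonormal U" and v: "v \<in> U"
  shows "ip (\<Sum>u\<in>U. c u *\<^sub>R u) v = c v"
proof -
  have "ip (\<Sum>u\<in>U. c u *\<^sub>R u) v = (\<Sum>u\<in>U. c u * ip u v)"
    using U v by (intro ip_sum_left) (auto simp: orthonormal_def)
  also have "\<dots> = (\<Sum>u\<in>U. if u = v then c v else 0)"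
    using U v by (intro sum.cong) (auto simp: orthonormal_def)
  finally show ?thesis using U v by (simp add: orthonormal_def)
qed

lemma orthonormal_expansion:
  assumes U: "orthonormal U" and x: "x \<in> span U"
  shows "x = (\<Sum>u\<in>U. ip x u *\<^sub>R u)"
proof -
  have "finite U" using U by (simp add: orthonormal_def)
  then obtain c where c: "x = (\<Sum>u\<in>U. c u *\<^sub>R u)"
    using x by (auto simp: span_finite)
  have "ip x u = c u" if "u \<in> U" for u
    unfolding c by (rule ip_orthonormal_sum[OF U that])
  then show ?thesis using c by (metis (no_types, lifting) sum.cong)
qed

lemma orthonormal_parseval:
  assumes U: "orthonormal U" and x: "x \<in> V" and y: "y \<in> span U"
  shows "ip x y = (\<Sum>u\<in>U. ip x u * ip y u)"
proof -
  have "ip x y = ip x (\<Sum>u\<in>U. ip y u *\<^sub>R u)"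
    using orthonormal_expansion[OF U y] by simp
  also have "\<dots> = (\<Sum>u\<in>U. ip y u * ip x u)"
    using U x by (intro ip_sum_right) (auto simp: orthonormal_def)
  finally show ?thesis by (simp add: mult.commute)
qed

lemma bessel:
  assumes U: "orthonormal U" and x: "x \<in> V"
  shows "(\<Sum>u\<in>U. (ip x u)\<^sup>2) \<le> ip x x"
proof -
  define y where "y = (\<Sum>u\<in>U. ip x u *\<^sub>R u)"
  have UV: "U \<subseteq> V" using U by (auto simp: orthonormal_def)
  have y: "y \<in> span U" unfolding y_def by (intro span_sum span_scale span_base)
  then have yV: "y \<in> V" using span_in_V UV by auto
  have yu: "ip y u = ip x u" if "u \<in> U" for u
    unfolding y_def by (rule ip_orthonormal_sum[OF U that])
  have xy: "ip x y = (\<Sum>u\<in>U. (ip x u)\<^sup>2)"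
    using orthonormal_parseval[OF U x y] yu by (simp add: power2_eq_square)
  have yy: "ip y y = (\<Sum>u\<in>U. (ip x u)\<^sup>2)"
    using orthonormal_parseval[OF U yV y] yu by (simp add: power2_eq_square)
  have "0 \<le> ip (x - y) (x - y)" using x yV by (intro ip_nonneg V_closed)
  also have "\<dots> = ip x (x - y) - ip y (x - y)" using x yV V_closed by (intro ip_diff_left) auto
  also have "\<dots> = ip (x - y) x - ip (x - y) y"
    using ip_sym[of x "x - y"] ip_sym[of y "x - y"] x yV V_closed by simp
  also have "\<dots> = ip x x - ip y x - (ip x y - ip y y)" using x yV by (simp add: ip_diff_left)
  also have "\<dots> = ip x x - ip x y" using ip_sym[OF yV x] xy yy by simp
  finally show ?thesis using xy by simp
qed

lemma orthonormal_independent: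
  assumes U: "orthonormal U"
  shows "independent U"
proof (rule independent_if_scalars_zero)
  show "finite U" using U by (simp add: orthonormal_def)
  fix c v assume "(\<Sum>u\<in>U. c u *\<^sub>R u) = 0" "v \<in> U"
  then show "c v = 0"
    using ip_orthonormal_sum[OF U \<open>v \<in> U\<close>, of c] U ip_zero_left[of v] by (auto simp: orthonormal_def)
qed

text \<open>Gram-Schmidt, one vector of \<^term>\<open>B\<close> at a time. Extending a given system, rather than starting from
  nothing, yields orthonormal bases adapted to a pair of nested spaces.\<close>

lemma orthonormal_extend:
  assumes U: "orthonormal U" and B: "finite B" "B \<subseteq> V"
  shows "\<exists>W. orthonormal W \<and> U \<subseteq> W \<and> span W = span (U \<union> B) \<and> card W \<le> card U + card B"
  using B
proof (induction B rule: finite_induct)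
  case empty
  then show ?case using U by (intro exI[of _ U]) auto
next
  case (insert b B)
  then obtain W where W: "orthonormal W" "U \<subseteq> W" "span W = span (U \<union> B)" "card W \<le> card U + card B"
    by auto
  have bV: "b \<in> V" using insert by auto
  have WV: "W \<subseteq> V" and fW: "finite W" using W by (auto simp: orthonormal_def)
  define p where "p = (\<Sum>u\<in>W. ip b u *\<^sub>R u)"
  have p: "p \<in> span W" unfolding p_def by (intro span_sum span_scale span_base)
  then have pV: "p \<in> V" using span_in_V WV by auto
  define e where "e = b - p"
  have eV: "e \<in> V" unfolding e_def using bV pV V_closed by auto
  have eu: "ip e u = 0" if "u \<in> W" for u
    unfolding e_def using ip_diff_left[OF bV pV, of u] ip_orthonormal_sum[OF W(1) that, of "ip b"] that WV
    by (auto simp: p_def)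
  have spb: "span (U \<union> insert b B) = span (insert b W)"
  proof -
    have "span (U \<union> insert b B) = span (insert b (U \<union> B))" by simp
    also have "\<dots> = span (insert b W)"
      unfolding span_insert using W(3) by simp
    finally show ?thesis .
  qed
  show ?case
  proof (cases "e = 0")
    case True
    then have "b \<in> span W" using p by (simp add: e_def)
    then have "span (insert b W) = span W" by (rule span_redundant)
    then show ?thesis using W spb insert by (intro exI[of _ W]) auto
  next
    case False
    define n where "n = sqrt (ip e e)"
    have "ip e e \<noteq> 0" using False ip_definite[OF eV] by blast
    then have npos: "n > 0" using ip_nonneg[OF eV] by (simp add: n_def)
    define h where "h = (1 / n) *\<^sub>R e"
    have hV: "h \<in> V" unfolding h_def using eV V_closed by auto
    have hu: "ip h u = 0" "ip u h = 0" if "u \<in> W" for u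
      using ip_scale[OF eV, of u "1 / n"] eu[OF that] that WV ip_sym[OF hV, of u] unfolding h_def by auto
    have "ip h h = (1 / n) * ip e h" unfolding h_def using eV hV by (intro ip_scale) (auto simp: h_def)
    also have "ip e h = (1 / n) * ip e e"
      unfolding h_def using ip_sum_right[of "{e}" id e "\<lambda>_. 1 / n"] eV by simp
    also have "ip e e = n * n" unfolding n_def using ip_nonneg[OF eV] by simp
    finally have hh: "ip h h = 1" using npos by simp
    have hW: "h \<notin> W" using hu hh by auto
    have on: "orthonormal (insert h W)"
      using W(1) hV hu hh hW unfolding orthonormal_def by auto
    have "span (insert h W) = span (insert b W)"
    proof (rule span_eq[THEN iffD2], intro conjI)
      have "b = n *\<^sub>R h + p" using npos by (simp add: h_def e_def)
      moreover have "p \<in> span (insert h W)" using p span_mono[of W "insert h W"] by auto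
      ultimately have "b \<in> span (insert h W)" by (auto intro!: span_add span_scale intro: span_base)
      then show "insert b W \<subseteq> span (insert h W)" by (auto intro: span_base)
      have "p \<in> span (insert b W)" using p span_mono[of W "insert b W"] by auto
      then have "h \<in> span (insert b W)" unfolding h_def e_def
        by (auto intro!: span_diff span_scale intro: span_base)
      then show "insert h W \<subseteq> span (insert b W)" by (auto intro: span_base)
    qed
    then show ?thesis using on spb W insert fW hW
      by (intro exI[of _ "insert h W"]) auto
  qed
qed

end

section \<open>Polynomials on the sphere\<close>

lemma scaleR_fun_apply: "(c *\<^sub>R f) x = c *\<^sub>R f x"
  by (simp add: scaleR_fun_def)

lemma linear_on_sphere: "linear on_sphere"
  by (rule linearI) (auto simp: on_sphere_def fun_eq_iff scaleR_fun_apply)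

text \<open>Reduces closure properties of polynomial spaces to monomials.\<close>

lemma linear_span_into:
  assumes "linear T" "subspace W" "\<And>s. s \<in> S \<Longrightarrow> T s \<in> W" "x \<in> span S"
  shows "T x \<in> W"
proof -
  have "T x \<in> span (T ` S)" using assms(1,4) linear_span_image by blast
  moreover have "span (T ` S) \<subseteq> W" using assms(2,3) by (intro span_minimal) auto
  ultimately show ?thesis by blast
qed

lemma sph_space_span:
  "sph_space L = span (on_sphere ` {monomial_fun \<alpha> |\<alpha>. (\<Sum>i\<in>UNIV. \<alpha> i) \<le> L} :: (real ^ 'n::finite \<Rightarrow> real) set)"
  unfolding sph_space_def polys_upto_def by (rule linear_span_image[OF linear_on_sphere, symmetric])

lemma subspace_sph_space: "subspace (sph_space L)"
  unfolding sph_space_span by (rule subspace_span)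

lemmas sph_space_closed = subspace_add[OF subspace_sph_space] subspace_diff[OF subspace_sph_space]
  subspace_scale[OF subspace_sph_space] subspace_0[OF subspace_sph_space] subspace_sum[OF subspace_sph_space]

lemma on_sphere_monomial:
  "(\<Sum>i\<in>UNIV. \<alpha> i) \<le> L \<Longrightarrow> on_sphere (monomial_fun \<alpha>) \<in> sph_space L"
  unfolding sph_space_span by (rule span_base) blast

lemma sph_space_mono: "L \<le> L' \<Longrightarrow> sph_space L \<subseteq> sph_space L'"
  unfolding sph_space_span by (intro span_mono image_mono) auto

lemma sph_space_zero: "f \<in> sph_space L \<Longrightarrow> x \<notin> sphere 0 1 \<Longrightarrow> f x = 0"
  unfolding sph_space_def on_sphere_def by auto

lemma sph_space_continuous:
  assumes "f \<in> sph_space L"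
  shows "continuous_on (sphere 0 1) f"
  using assms unfolding sph_space_span
proof (induction rule: span_induct)
  case base
  show ?case
    by (rule subspaceI)
       (auto simp: zero_fun_def plus_fun_def scaleR_fun_def intro!: continuous_intros)
next
  case (step f)
  then obtain \<alpha> where f: "f = on_sphere (monomial_fun \<alpha>)" by auto
  have "continuous_on (sphere 0 1) (monomial_fun \<alpha>)"
    unfolding monomial_fun_def by (intro continuous_intros)
  then show ?case unfolding f on_sphere_def by (rule continuous_on_eq) auto
qed

lemma sph_space_mult:
  fixes f g :: "real ^ 'n::finite \<Rightarrow> real"
  assumes f: "f \<in> sph_space a" and g: "g \<in> sph_space b"
  shows "(\<lambda>x. f x * g x) \<in> sph_space (a + b)"
proof -
  have left: "linear (\<lambda>f x. f x * g x)" and right: "linear (\<lambda>g x. f x * g x)" for f g :: "real ^ 'n \<Rightarrow> real"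
    by (rule linearI; simp add: fun_eq_iff scaleR_fun_apply algebra_simps)+
  show ?thesis
  proof (rule linear_span_into[OF left subspace_sph_space _ f[unfolded sph_space_span]])
    fix p :: "real ^ 'n \<Rightarrow> real" assume "p \<in> on_sphere ` {monomial_fun \<alpha> |\<alpha>. (\<Sum>i\<in>UNIV. \<alpha> i) \<le> a}"
    then obtain \<alpha> where \<alpha>: "p = on_sphere (monomial_fun \<alpha>)" "(\<Sum>i\<in>UNIV. \<alpha> i) \<le> a" by auto
    show "(\<lambda>x. p x * g x) \<in> sph_space (a + b)"
    proof (rule linear_span_into[OF right subspace_sph_space _ g[unfolded sph_space_span]])
      fix q :: "real ^ 'n \<Rightarrow> real" assume "q \<in> on_sphere ` {monomial_fun \<beta> |\<beta>. (\<Sum>i\<in>UNIV. \<beta> i) \<le> b}"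
      then obtain \<beta> where \<beta>: "q = on_sphere (monomial_fun \<beta>)" "(\<Sum>i\<in>UNIV. \<beta> i) \<le> b" by auto
      have "on_sphere (monomial_fun (\<lambda>i. \<alpha> i + \<beta> i)) \<in> sph_space (a + b)"
        using \<alpha> \<beta> by (intro on_sphere_monomial) (simp add: sum.distrib)
      also have "on_sphere (monomial_fun (\<lambda>i. \<alpha> i + \<beta> i)) = (\<lambda>x. p x * q x)"
        unfolding \<alpha> \<beta> on_sphere_def monomial_fun_def by (auto simp: power_add prod.distrib)
      finally show "(\<lambda>x. p x * q x) \<in> sph_space (a + b)" .
    qed
  qed
qed

lemma on_sphere_mult:
  assumes "on_sphere p \<in> sph_space a" "on_sphere q \<in> sph_space b"
  shows "on_sphere (\<lambda>x. p x * q x) \<in> sph_space (a + b)"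
proof -
  have "on_sphere (\<lambda>x. p x * q x) = (\<lambda>x. on_sphere p x * on_sphere q x)"
    by (auto simp: on_sphere_def)
  then show ?thesis using sph_space_mult[OF assms] by simp
qed

lemma on_sphere_const: "on_sphere (\<lambda>x. c) \<in> sph_space L"
proof -
  have "c *\<^sub>R on_sphere (monomial_fun (\<lambda>_. 0)) \<in> sph_space L"
    by (intro sph_space_closed on_sphere_monomial) auto
  also have "c *\<^sub>R on_sphere (monomial_fun (\<lambda>_. 0)) = on_sphere (\<lambda>x. c)"
    by (auto simp: scaleR_fun_def on_sphere_def monomial_fun_def)
  finally show ?thesis .
qed

lemma on_sphere_power:
  "on_sphere p \<in> sph_space a \<Longrightarrow> on_sphere (\<lambda>x. p x ^ n) \<in> sph_space (n * a)"
  by (induction n) (auto intro: on_sphere_const on_sphere_mult)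

lemma on_sphere_prod:
  "(\<And>i. i \<in> I \<Longrightarrow> on_sphere (g i) \<in> sph_space (a i)) \<Longrightarrow>
    on_sphere (\<lambda>x. \<Prod>i\<in>I. g i x) \<in> sph_space (\<Sum>i\<in>I. a i)"
  by (induction I rule: infinite_finite_induct) (auto intro: on_sphere_const on_sphere_mult)

lemma on_sphere_add:
  assumes "on_sphere p \<in> sph_space L" "on_sphere q \<in> sph_space L"
  shows "on_sphere (\<lambda>x. p x + q x) \<in> sph_space L"
  using sph_space_closed(1)[OF assms] linear_add[OF linear_on_sphere, of p q] by (simp add: plus_fun_def)

lemma on_sphere_coord: "on_sphere (\<lambda>x :: real ^ 'n::finite. vec_nth x i) \<in> sph_space 1"
proof -
  have "on_sphere (monomial_fun (\<lambda>j. if j = i then 1 else 0)) \<in> sph_space 1"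
    by (rule on_sphere_monomial) simp
  also have "monomial_fun (\<lambda>j. if j = i then 1 else 0) = (\<lambda>x :: real ^ 'n. vec_nth x i)"
    unfolding monomial_fun_def by (simp add: if_distrib cong: if_cong)
  finally show ?thesis .
qed

lemma on_sphere_linear:
  fixes p :: "real ^ 'n::finite \<Rightarrow> real"
  assumes "linear p"
  shows "on_sphere p \<in> sph_space 1"
proof -
  define q where "q = (\<Sum>j\<in>UNIV. p (axis j 1) *\<^sub>R (\<lambda>x :: real ^ 'n. vec_nth x j))"
  have "p x = q x" for x
  proof -
    have "p x = p (\<Sum>j\<in>UNIV. vec_nth x j *\<^sub>R axis j 1)"
      using basis_expansion[of x] by (simp add: scalar_mult_eq_scaleR)
    also have "\<dots> = q x"
      using assms unfolding q_def
      by (simp add: linear_sum linear_cmul sum_fun_apply scaleR_fun_apply mult.commute)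
    finally show ?thesis .
  qed
  then have "on_sphere p = on_sphere q" by (intro arg_cong[where f = on_sphere] ext)
  also have "\<dots> = (\<Sum>j\<in>UNIV. p (axis j 1) *\<^sub>R on_sphere (\<lambda>x. vec_nth x j))"
    unfolding q_def by (simp add: linear_sum[OF linear_on_sphere] linear_cmul[OF linear_on_sphere])
  also have "\<dots> \<in> sph_space 1" by (intro sph_space_closed(5,3) on_sphere_coord)
  finally show ?thesis .
qed

lemma sph_space_rotate:
  fixes f :: "real ^ 'n::finite \<Rightarrow> real"
  assumes f: "f \<in> sph_space L" and \<rho>: "orthogonal_transformation \<rho>"
  shows "(\<lambda>x. f (\<rho> x)) \<in> sph_space L"
proof (rule linear_span_into[OF _ subspace_sph_space _ f[unfolded sph_space_span]])
  show "linear (\<lambda>(f :: real ^ 'n \<Rightarrow> real) x. f (\<rho> x))"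
    by (rule linearI) (simp_all add: fun_eq_iff scaleR_fun_apply)
  fix f :: "real ^ 'n \<Rightarrow> real" assume "f \<in> on_sphere ` {monomial_fun \<alpha> |\<alpha>. (\<Sum>i\<in>UNIV. \<alpha> i) \<le> L}"
  then obtain \<alpha> where \<alpha>: "f = on_sphere (monomial_fun \<alpha>)" "(\<Sum>i\<in>UNIV. \<alpha> i) \<le> L" by auto
  have nrm: "norm (\<rho> x) = norm x" for x using \<rho> by (rule orthogonal_transformation_norm)
  have "linear (\<lambda>x. vec_nth (\<rho> x) i)" for i
    using linear_compose[OF orthogonal_transformation_linear[OF \<rho>] bounded_linear.linear[OF bounded_linear_vec_nth[of i]]]
    by (simp add: o_def)
  then have "on_sphere (\<lambda>x. \<Prod>i\<in>UNIV. vec_nth (\<rho> x) i ^ \<alpha> i) \<in> sph_space (\<Sum>i\<in>UNIV. \<alpha> i * 1)"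
    by (intro on_sphere_prod on_sphere_power on_sphere_linear)
  then have "on_sphere (\<lambda>x. \<Prod>i\<in>UNIV. vec_nth (\<rho> x) i ^ \<alpha> i) \<in> sph_space L"
    using sph_space_mono[OF \<alpha>(2)] by auto
  also have "on_sphere (\<lambda>x. \<Prod>i\<in>UNIV. vec_nth (\<rho> x) i ^ \<alpha> i) = (\<lambda>x. f (\<rho> x))"
    unfolding \<alpha> by (auto simp: on_sphere_def monomial_fun_def nrm)
  finally show "(\<lambda>x. f (\<rho> x)) \<in> sph_space L" .
qed

text \<open>Links the polynomials of the Stone-Weierstrass theorem to the spaces graded by degree.\<close>

lemma on_sphere_polynomial:
  fixes p :: "real ^ 'n::finite \<Rightarrow> real"
  assumes "real_polynomial_function p"
  shows "\<exists>L. on_sphere p \<in> sph_space L"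
  using assms
proof induction
  case (linear f)
  then show ?case using on_sphere_linear bounded_linear.linear by blast
next
  case (const c)
  then show ?case using on_sphere_const by blast
next
  case (add f g)
  then obtain a b where "on_sphere f \<in> sph_space a" "on_sphere g \<in> sph_space b" by auto
  then have "on_sphere f \<in> sph_space (max a b)" "on_sphere g \<in> sph_space (max a b)"
    using sph_space_mono[of a "max a b"] sph_space_mono[of b "max a b"] by auto
  then show ?case using on_sphere_add by blast
next
  case (mult f g)
  then show ?case using on_sphere_mult by blast
qed

lemma finite_multiindices: "finite {\<alpha> :: 'n::finite \<Rightarrow> nat. (\<Sum>i\<in>UNIV. \<alpha> i) \<le> L}"
proof (rule finite_subset)
  show "{\<alpha> :: 'n \<Rightarrow> nat. (\<Sum>i\<in>UNIV. \<alpha> i) \<le> L} \<subseteq> PiE UNIV (\<lambda>_. {..L})"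
  proof
    fix \<alpha> :: "'n \<Rightarrow> nat" assume "\<alpha> \<in> {\<alpha>. (\<Sum>i\<in>UNIV. \<alpha> i) \<le> L}"
    then have sum: "(\<Sum>i\<in>UNIV. \<alpha> i) \<le> L" by simp
    have "\<alpha> i \<le> L" for i
      using member_le_sum[of i UNIV \<alpha>] sum by simp
    then show "\<alpha> \<in> PiE UNIV (\<lambda>_. {..L})" by (simp add: PiE_def)
  qed
qed (auto intro: finite_PiE)

lemma finite_sph_generators:
  "finite (on_sphere ` {monomial_fun \<alpha> |\<alpha>. (\<Sum>i\<in>UNIV. \<alpha> i) \<le> L} :: (real ^ 'n::finite \<Rightarrow> real) set)"
proof -
  have "{monomial_fun \<alpha> |\<alpha>. (\<Sum>i\<in>UNIV. \<alpha> i) \<le> L} = (monomial_fun ` {\<alpha>. (\<Sum>i\<in>UNIV. \<alpha> i) \<le> L} :: (real ^ 'n \<Rightarrow> real) set)"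
    by blast
  then show ?thesis using finite_multiindices[where 'n='n and L=L] by (metis finite_imageI)
qed

lemma sph_dim_eq_card:
  fixes U :: "(real ^ 'n::finite \<Rightarrow> real) set"
  assumes "independent U" "span U = sph_space L"
  shows "sph_dim TYPE('n) L = card U"
proof -
  have "span U = span (sph_space L)" using assms(2) subspace_sph_space by (metis span_eq_iff)
  then show ?thesis unfolding sph_dim_def using dim_eq_card[OF _ assms(1)] by simp
qed

section \<open>The mean over the sphere\<close>

definition sphere_mean :: "(real ^ 'n::finite \<Rightarrow> real) \<Rightarrow> real" where
  "sphere_mean F = (1 / measure surface_measure (sphere (0 :: real ^ 'n) 1)) * (LINT x|surface_measure. F x)"

abbreviation punctured :: "(real ^ 'n::finite) set" where
  "punctured \<equiv> cball 0 1 - {0}"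

lemma nn_integral_lborel_translate:
  fixes c :: "'a::euclidean_space"
  assumes "h \<in> borel_measurable borel"
  shows "(\<integral>\<^sup>+ x. h (c + x) \<partial>lborel) = (\<integral>\<^sup>+ x. h x \<partial>lborel)"
proof -
  have "(\<integral>\<^sup>+ x. h x \<partial>lborel) = (\<integral>\<^sup>+ x. h x \<partial>distr lborel borel ((+) c))"
    by (simp add: lborel_distr_plus)
  also have "\<dots> = (\<integral>\<^sup>+ x. h (c + x) \<partial>lborel)" using assms by (subst nn_integral_distr) auto
  finally show ?thesis by simp
qed

text \<open>The image measure \<open>\<nu>\<close> is invariant under translations, so it is a multiple of
  Lebesgue measure \<open>\<lambda>\<close>; the factor is 1 because the unit ball \<open>B\<close> is preserved. The computation below
  carries this out for a single set \<open>E\<close>: evaluating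
  \<open>\<integral>\<integral> 1\<^sub>B(y) 1\<^sub>E(\<rho> x + y) dx dy\<close> in both orders gives \<open>\<nu>(E) \<lambda>(B) = \<lambda>(E) \<lambda>(B)\<close>.\<close>

lemma lborel_distr_orthogonal:
  fixes \<rho> :: "'a::euclidean_space \<Rightarrow> 'a"
  assumes \<rho>: "orthogonal_transformation \<rho>"
  shows "distr lborel borel \<rho> = lborel"
proof (rule measure_eqI)
  have lin: "linear \<rho>" using \<rho> by (rule orthogonal_transformation_linear)
  then have meas [measurable]: "\<rho> \<in> borel_measurable borel"
    by (intro borel_measurable_continuous_onI linear_continuous_on linear_conv_bounded_linear[THEN iffD1])
  have bij: "bij \<rho>" using \<rho> by (rule orthogonal_transformation_bij)
  define \<tau> where "\<tau> = inv_into UNIV \<rho>"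
  have \<rho>\<tau>: "\<rho> (\<tau> y) = y" for y
    unfolding \<tau>_def using bij by (simp add: bij_is_surj surj_f_inv_f)
  fix E assume "E \<in> sets (distr lborel borel \<rho>)"
  then have E [measurable]: "E \<in> sets borel" by simp
  let ?B = "ball 0 1 :: 'a set"
  have [measurable]: "\<rho> \<in> lborel \<rightarrow>\<^sub>M borel" using meas by simp
  have add_meas: "(\<lambda>p. \<rho> (fst p) + snd p) \<in> lborel \<Otimes>\<^sub>M lborel \<rightarrow>\<^sub>M borel" by measurable
  define F :: "'a \<Rightarrow> 'a \<Rightarrow> ennreal" where "F x y = indicator ?B y * indicator E (\<rho> x + y)" for x y
  have F_meas [measurable]: "case_prod F \<in> borel_measurable (lborel \<Otimes>\<^sub>M lborel)"
    unfolding F_def case_prod_beta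
    by (intro borel_measurable_times_ennreal measurable_compose[OF add_meas] measurable_compose[OF measurable_snd])
       (auto intro!: borel_measurable_indicator)
  have diff_meas: "(\<lambda>p. snd p - \<rho> (fst p)) \<in> lborel \<Otimes>\<^sub>M lborel \<rightarrow>\<^sub>M borel" by measurable
  define G :: "'a \<Rightarrow> 'a \<Rightarrow> ennreal" where "G x y = indicator ?B (y - \<rho> x) * indicator E y" for x y
  have G_meas [measurable]: "case_prod G \<in> borel_measurable (lborel \<Otimes>\<^sub>M lborel)"
    unfolding G_def case_prod_beta
    by (intro borel_measurable_times_ennreal measurable_compose[OF diff_meas] measurable_compose[OF measurable_snd])
       (auto intro!: borel_measurable_indicator)
  have "emeasure (distr lborel borel \<rho>) E * emeasure lborel ?B
      = (\<integral>\<^sup>+ y. emeasure (distr lborel borel \<rho>) E * indicator ?B y \<partial>lborel)"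
    by (rule nn_integral_cmult_indicator[symmetric]) simp
  also have "\<dots> = (\<integral>\<^sup>+ y. (\<integral>\<^sup>+ x. F x y \<partial>lborel) \<partial>lborel)"
  proof (rule nn_integral_cong)
    fix y
    have "emeasure (distr lborel borel \<rho>) E = (\<integral>\<^sup>+ x. indicator E (\<rho> x) \<partial>lborel)"
      by (simp add: nn_integral_distr flip: nn_integral_indicator)
    also have "\<dots> = (\<integral>\<^sup>+ x. indicator E (\<rho> (\<tau> y + x)) \<partial>lborel)"
      by (rule nn_integral_lborel_translate[symmetric]) measurable
    also have "\<dots> = (\<integral>\<^sup>+ x. indicator E (\<rho> x + y) \<partial>lborel)"
      by (simp add: linear_add[OF lin] \<rho>\<tau> add.commute)
    finally show "emeasure (distr lborel borel \<rho>) E * indicator ?B y = (\<integral>\<^sup>+ x. F x y \<partial>lborel)"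
      unfolding F_def by (subst nn_integral_cmult) (measurable, simp add: mult.commute)
  qed
  \<comment> \<open>the outer variable is now \<open>x\<close>, and the shift by \<open>\<rho> x\<close> can be moved from \<open>E\<close> to the ball\<close>
  also have "\<dots> = (\<integral>\<^sup>+ x. (\<integral>\<^sup>+ y. F x y \<partial>lborel) \<partial>lborel)"
    by (rule lborel_pair.Fubini') (rule F_meas)
  also have "\<dots> = (\<integral>\<^sup>+ x. (\<integral>\<^sup>+ y. G x y \<partial>lborel) \<partial>lborel)"
  proof (rule nn_integral_cong)
    fix x
    have "(\<integral>\<^sup>+ y. G x (\<rho> x + y) \<partial>lborel) = (\<integral>\<^sup>+ y. G x y \<partial>lborel)"
      unfolding G_def
      by (intro nn_integral_lborel_translate borel_measurable_times_ennreal borel_measurable_indicator E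
            measurable_compose[of "\<lambda>y. y - \<rho> x" borel borel "indicator ?B"]) measurable
    then show "(\<integral>\<^sup>+ y. F x y \<partial>lborel) = (\<integral>\<^sup>+ y. G x y \<partial>lborel)" by (simp add: F_def G_def)
  qed
  also have "\<dots> = (\<integral>\<^sup>+ y. (\<integral>\<^sup>+ x. G x y \<partial>lborel) \<partial>lborel)"
    by (rule lborel_pair.Fubini'[symmetric]) (rule G_meas)
  also have "\<dots> = (\<integral>\<^sup>+ y. emeasure lborel ?B * indicator E y \<partial>lborel)"
  proof (rule nn_integral_cong)
    fix y
    have "indicator ?B (y - \<rho> x) = (indicator (ball (\<tau> y) 1) x :: ennreal)" for x
    proof -
      have "norm (y - \<rho> x) = norm (\<rho> (\<tau> y - x))" by (simp add: linear_diff[OF lin] \<rho>\<tau>)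
      then have "norm (y - \<rho> x) = norm (\<tau> y - x)" using orthogonal_transformation_norm[OF \<rho>] by simp
      then show ?thesis by (simp add: indicator_def dist_norm norm_minus_commute[of "\<rho> x" y])
    qed
    then have "(\<integral>\<^sup>+ x. G x y \<partial>lborel) = emeasure lborel (ball (\<tau> y) 1) * indicator E y"
      unfolding G_def
      by (simp add: nn_integral_cmult_indicator mult.commute[of _ "indicator E y"] mult.commute[of "emeasure _ _"])
    then show "(\<integral>\<^sup>+ x. G x y \<partial>lborel) = emeasure lborel ?B * indicator E y" by (simp add: emeasure_ball)
  qed
  also have "\<dots> = emeasure lborel E * emeasure lborel ?B"
    using nn_integral_cmult_indicator[of E lborel "emeasure lborel ?B"] E by (simp add: mult.commute)
  finally have "emeasure lborel ?B * emeasure (distr lborel borel \<rho>) E = emeasure lborel ?B * emeasure lborel E"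
    by (simp add: mult.commute)
  moreover have "unit_ball_vol (real DIM('a)) \<noteq> 0"
    using unit_ball_vol_pos[of "real DIM('a)"] by linarith
  then have "emeasure lborel ?B \<noteq> 0" "emeasure lborel ?B \<noteq> \<infinity>"
    by (simp_all add: emeasure_ball)
  ultimately show "emeasure (distr lborel borel \<rho>) E = emeasure lborel E"
    by (simp add: ennreal_mult_cancel_left)
qed simp

lemma radial_projection_measurable:
  "(\<lambda>x. x /\<^sub>R norm x) \<in> restrict_space lborel punctured \<rightarrow>\<^sub>M restrict_space borel (sphere (0 :: real ^ 'n::finite) 1)"
proof (rule measurable_restrict_space3)
  show "(\<lambda>x :: real ^ 'n. x /\<^sub>R norm x) \<in> lborel \<rightarrow>\<^sub>M borel" by measurable
  show "(\<lambda>x :: real ^ 'n. x /\<^sub>R norm x) \<in> punctured \<rightarrow> sphere 0 1" by auto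
qed

lemma finite_measure_punctured: "finite_measure (restrict_space lborel (punctured :: (real ^ 'n::finite) set))"
proof (rule finite_measureI)
  have "emeasure (restrict_space lborel punctured) (space (restrict_space lborel (punctured :: (real ^ 'n) set)))
      = emeasure lborel (punctured :: (real ^ 'n) set)"
    by (subst emeasure_restrict_space) (auto simp: space_restrict_space)
  also have "\<dots> < \<infinity>"
    by (rule emeasure_bounded_finite) (auto intro: bounded_subset[OF bounded_cball])
  finally show "emeasure (restrict_space lborel punctured) (space (restrict_space lborel (punctured :: (real ^ 'n) set))) \<noteq> \<infinity>"
    by simp
qed

lemma punctured_measure_pos: "0 < measure lborel (punctured :: (real ^ 'n::finite) set)"
proof -
  have "emeasure lborel (punctured :: (real ^ 'n) set) < \<infinity>"
    by (rule emeasure_bounded_finite) (auto intro: bounded_subset[OF bounded_cball])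
  moreover obtain v :: "real ^ 'n" where v: "norm v = 1/2"
    using vector_choose_size[of "1/2"] by auto
  have "ball v (1/2) \<subseteq> punctured"
  proof
    fix y assume y: "y \<in> ball v (1/2)"
    have "norm y \<le> norm v + norm (y - v)" using norm_triangle_ineq[of v "y - v"] by simp
    then show "y \<in> punctured" using y v by (auto simp: dist_norm norm_minus_commute)
  qed
  then have "emeasure lborel (ball v (1/2)) \<le> emeasure lborel (punctured :: (real ^ 'n) set)"
    by (intro emeasure_mono) auto
  moreover have "0 < emeasure lborel (ball v (1/2))"
    by (simp add: emeasure_ball unit_ball_vol_def ennreal_zero_less_mult_iff)
  ultimately show ?thesis by (auto simp: measure_def enn2real_positive_iff)
qed

lemma surface_measure_density:
  "surface_measure = density (distr (restrict_space lborel punctured) (restrict_space borel (sphere 0 1)) (\<lambda>x. x /\<^sub>R norm x))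
     (\<lambda>x :: real ^ 'n::finite. real CARD('n))"
  unfolding surface_measure_def
  by (rule measure_eqI) (auto simp: emeasure_density_const ennreal_of_nat_eq_real_of_nat)

text \<open>The surface measure is the radial image of Lebesgue measure on the punctured ball, up to a
  factor that cancels in the mean.\<close>

lemma sphere_mean_eq:
  assumes F: "continuous_on (sphere 0 1) (F :: real ^ 'n::finite \<Rightarrow> real)"
  shows "sphere_mean F = (LINT x|restrict_space lborel punctured. F (x /\<^sub>R norm x)) / measure lborel (punctured :: (real ^ 'n) set)"
proof -
  have Fm: "F \<in> borel_measurable (restrict_space borel (sphere 0 1))"
    using F by (rule borel_measurable_continuous_on_restrict)
  have "(LINT x|surface_measure. F x) = real CARD('n) * (LINT x|restrict_space lborel punctured. F (x /\<^sub>R norm x))"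
    unfolding surface_measure_density using Fm
    by (subst integral_density) (auto simp: integral_distr[OF radial_projection_measurable Fm])
  moreover have "measure surface_measure (sphere (0 :: real ^ 'n) 1) = real CARD('n) * measure lborel (punctured :: (real ^ 'n) set)"
  proof -
    have "emeasure surface_measure (sphere (0 :: real ^ 'n) 1)
      = of_nat CARD('n) * emeasure (restrict_space lborel punctured) ((\<lambda>x. x /\<^sub>R norm x) -` sphere (0 :: real ^ 'n) 1 \<inter> space (restrict_space lborel punctured))"
      unfolding surface_measure_def emeasure_scale_measure
      by (subst emeasure_distr[OF radial_projection_measurable]) (auto simp: sets_restrict_space)
    also have "(\<lambda>x. x /\<^sub>R norm x) -` sphere (0 :: real ^ 'n) 1 \<inter> space (restrict_space lborel punctured) = punctured"
      by (auto simp: space_restrict_space)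
    also have "emeasure (restrict_space lborel punctured) (punctured :: (real ^ 'n) set) = emeasure lborel (punctured :: (real ^ 'n) set)"
      by (subst emeasure_restrict_space) auto
    finally show ?thesis by (simp add: measure_def enn2real_mult)
  qed
  ultimately show ?thesis unfolding sphere_mean_def by simp
qed

lemma sphere_mean_integrable:
  assumes F: "continuous_on (sphere 0 1) (F :: real ^ 'n::finite \<Rightarrow> real)"
  shows "integrable (restrict_space lborel punctured) (\<lambda>x. F (x /\<^sub>R norm x))"
proof -
  interpret finite_measure "restrict_space lborel (punctured :: (real ^ 'n) set)" by (rule finite_measure_punctured)
  have "bounded (F ` sphere 0 1)" using F by (intro compact_imp_bounded compact_continuous_image) auto
  then obtain C where C: "\<And>x. x \<in> sphere 0 1 \<Longrightarrow> norm (F x) \<le> C" unfolding bounded_iff by blast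
  show ?thesis
  proof (rule integrable_const_bound[of _ C])
    show "AE x in restrict_space lborel punctured. norm (F (x /\<^sub>R norm x)) \<le> C"
      by (rule AE_I2, rule C) (auto simp: space_restrict_space)
    show "(\<lambda>x. F (x /\<^sub>R norm x)) \<in> borel_measurable (restrict_space lborel punctured)"
      using measurable_compose[OF radial_projection_measurable borel_measurable_continuous_on_restrict[OF F]] .
  qed
qed

lemma sphere_mean_cong:
  assumes "continuous_on (sphere 0 1) (F :: real ^ 'n::finite \<Rightarrow> real)" "\<And>x. x \<in> sphere 0 1 \<Longrightarrow> F x = G x"
  shows "sphere_mean F = sphere_mean G"
proof -
  have G: "continuous_on (sphere 0 1) G" using assms continuous_on_cong by metis
  show ?thesis unfolding sphere_mean_eq[OF assms(1)] sphere_mean_eq[OF G]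
    using assms(2) by (auto intro!: arg_cong2[where f="(/)"] Bochner_Integration.integral_cong simp: space_restrict_space)
qed

lemma sphere_mean_add:
  assumes "continuous_on (sphere 0 1) (F :: real ^ 'n::finite \<Rightarrow> real)" "continuous_on (sphere 0 1) G"
  shows "sphere_mean (\<lambda>x. F x + G x) = sphere_mean F + sphere_mean G"
  using assms by (simp add: sphere_mean_eq sphere_mean_integrable continuous_on_add add_divide_distrib)

lemma sphere_mean_cmult:
  assumes "continuous_on (sphere 0 1) (F :: real ^ 'n::finite \<Rightarrow> real)"
  shows "sphere_mean (\<lambda>x. c * F x) = c * sphere_mean F"
  using assms by (simp add: sphere_mean_eq continuous_on_mult_left)

lemma sphere_mean_const: "sphere_mean (\<lambda>x :: real ^ 'n::finite. c) = c"
proof -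
  have "measure (restrict_space lborel punctured) (space (restrict_space lborel (punctured :: (real ^ 'n) set)))
      = measure lborel (punctured :: (real ^ 'n) set)"
    by (subst measure_restrict_space) (auto simp: space_restrict_space)
  then show ?thesis using punctured_measure_pos[where 'n='n] by (simp add: sphere_mean_eq)
qed

lemma sphere_mean_mono:
  assumes "continuous_on (sphere 0 1) (F :: real ^ 'n::finite \<Rightarrow> real)" "continuous_on (sphere 0 1) G"
    and "\<And>x. x \<in> sphere 0 1 \<Longrightarrow> F x \<le> G x"
  shows "sphere_mean F \<le> sphere_mean G"
  using assms punctured_measure_pos[where 'n='n]
  by (auto simp: sphere_mean_eq space_restrict_space intro!: divide_right_mono integral_mono sphere_mean_integrable)

lemma sphere_mean_rotate:
  fixes \<rho> :: "real ^ 'n::finite \<Rightarrow> real ^ 'n"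
  assumes \<rho>: "orthogonal_transformation \<rho>" and F: "continuous_on (sphere 0 1) (F :: real ^ 'n::finite \<Rightarrow> real)"
  shows "sphere_mean (\<lambda>x. F (\<rho> x)) = sphere_mean F"
proof -
  have lin: "linear \<rho>" using \<rho> by (rule orthogonal_transformation_linear)
  then have cont: "continuous_on A \<rho>" for A
    by (intro linear_continuous_on linear_conv_bounded_linear[THEN iffD1])
  have meas: "\<rho> \<in> lborel \<rightarrow>\<^sub>M borel"
    using borel_measurable_continuous_onI[OF cont] by simp
  have nrm: "norm (\<rho> x) = norm x" for x using \<rho> by (rule orthogonal_transformation_norm)
  have F\<rho>: "continuous_on (sphere 0 1) (\<lambda>x. F (\<rho> x))"
    by (rule continuous_on_compose2[OF F cont]) (auto simp: nrm)
  define H :: "real ^ 'n \<Rightarrow> real" where "H x = indicator punctured x *\<^sub>R F (x /\<^sub>R norm x)" for x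
  have Hm: "H \<in> borel_measurable borel"
    using measurable_compose[OF radial_projection_measurable borel_measurable_continuous_on_restrict[OF F]]
    unfolding H_def by (subst (asm) borel_measurable_restrict_space_iff) (auto simp: mult.commute)
  have "(LINT x|restrict_space lborel punctured. F (\<rho> (x /\<^sub>R norm x)))
      = (LINT x|lborel. indicator punctured x *\<^sub>R F (\<rho> (x /\<^sub>R norm x)))"
    by (rule integral_restrict_space) simp
  also have "(\<lambda>x. indicator punctured x *\<^sub>R F (\<rho> (x /\<^sub>R norm x))) = (\<lambda>x. H (\<rho> x))"
  proof
    fix x
    have "\<rho> x = 0 \<longleftrightarrow> x = 0" using nrm[of x] by (metis norm_eq_zero)
    then show "indicator punctured x *\<^sub>R F (\<rho> (x /\<^sub>R norm x)) = H (\<rho> x)"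
      unfolding H_def by (auto simp: nrm linear_cmul[OF lin] indicator_def)
  qed
  also have "(LINT x|lborel. H (\<rho> x)) = (LINT x|distr lborel borel \<rho>. H x)"
    by (rule integral_distr[OF meas Hm, symmetric])
  also have "\<dots> = (LINT x|lborel. H x)" by (simp add: lborel_distr_orthogonal[OF \<rho>])
  also have "\<dots> = (LINT x|restrict_space lborel punctured. F (x /\<^sub>R norm x))"
    unfolding H_def by (rule integral_restrict_space[symmetric]) simp
  finally show ?thesis by (simp add: sphere_mean_eq[OF F] sphere_mean_eq[OF F\<rho>])
qed

text \<open>A nonzero value of \<^term>\<open>F\<close> at one point gives an open cone on which \<open>F (x / norm x)\<close> does not
  vanish, and nonempty open sets are not null.\<close>

lemma sphere_mean_definite:
  assumes F: "continuous_on (sphere 0 1) (F :: real ^ 'n::finite \<Rightarrow> real)"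
    and nonneg: "\<And>x. x \<in> sphere 0 1 \<Longrightarrow> 0 \<le> F x" and zero: "sphere_mean F = 0" and a: "a \<in> sphere 0 1"
  shows "F a = 0"
proof (rule ccontr)
  assume ne: "F a \<noteq> 0"
  let ?g = "\<lambda>x :: real ^ 'n. F (x /\<^sub>R norm x)"
  have "(LINT x|restrict_space lborel punctured. ?g x) = 0"
    using zero punctured_measure_pos[where 'n='n] by (simp add: sphere_mean_eq[OF F])
  then have "AE x in restrict_space lborel punctured. ?g x = 0"
    by (subst (asm) integral_nonneg_eq_0_iff_AE[OF sphere_mean_integrable[OF F]])
       (auto simp: space_restrict_space intro!: AE_I2 nonneg)
  then have AE: "AE x in lborel. x \<in> punctured \<longrightarrow> ?g x = 0"
    by (subst (asm) AE_restrict_space_iff) auto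
  let ?B = "ball 0 1 - {0} :: (real ^ 'n) set"
  have "continuous_on ?B ?g"
  proof (rule continuous_on_compose2[OF F])
    show "(\<lambda>x. x /\<^sub>R norm x) ` ?B \<subseteq> sphere 0 1" 
    proof (rule image_subsetI)
      fix x :: "real ^ 'n" assume "x \<in> ?B"
      then have "norm x \<noteq> 0" by simp
      then have "norm (x /\<^sub>R norm x) = 1" unfolding norm_scaleR by simp
      then show "x /\<^sub>R norm x \<in> sphere 0 1" by simp
    qed
  qed (intro continuous_intros; auto)
  then have op: "open (?B \<inter> ?g -` (- {0}))"
    by (rule continuous_open_preimage) auto
  have "?B \<inter> ?g -` (- {0}) \<subseteq> {x \<in> space lborel. \<not> (x \<in> punctured \<longrightarrow> ?g x = 0)}" by auto
  moreover obtain Z where Z: "{x \<in> space lborel. \<not> (x \<in> punctured \<longrightarrow> ?g x = 0)} \<subseteq> Z" "emeasure lborel Z = 0" "Z \<in> sets lborel"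
    using AE by (rule AE_E)
  ultimately have "emeasure lborel (?B \<inter> ?g -` (- {0})) \<le> emeasure lborel Z"
    by (intro emeasure_mono subset_trans[OF _ Z(1)])
  then have "?B \<inter> ?g -` (- {0}) \<in> null_sets lborel"
    using op Z(2) by (intro null_setsI) auto
  then have "negligible (?B \<inter> ?g -` (- {0}))"
    by (simp add: negligible_iff_null_sets null_sets_completionI)
  moreover have "(1/2) *\<^sub>R a \<in> ?B \<inter> ?g -` (- {0})" using a ne by auto
  ultimately show False using open_not_negligible[OF op] by blast
qed

section \<open>The reproducing kernel\<close>

definition sph_polys :: "(real ^ 'n::finite \<Rightarrow> real) set" where
  "sph_polys = (\<Union>L. sph_space L)"

definition sph_ip :: "(real ^ 'n::finite \<Rightarrow> real) \<Rightarrow> (real ^ 'n \<Rightarrow> real) \<Rightarrow> real" where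
  "sph_ip f g = sphere_mean (\<lambda>x. f x * g x)"

lemma sph_polysI: "f \<in> sph_space L \<Longrightarrow> f \<in> sph_polys"
  by (auto simp: sph_polys_def)

lemma sph_polys_continuous: "f \<in> sph_polys \<Longrightarrow> continuous_on (sphere 0 1) f"
  using sph_space_continuous by (auto simp: sph_polys_def)

lemma sph_polys_common:
  assumes "f \<in> sph_polys" "g \<in> sph_polys"
  obtains L where "f \<in> sph_space L" "g \<in> sph_space L"
proof -
  obtain a b where "f \<in> sph_space a" "g \<in> sph_space b" using assms by (auto simp: sph_polys_def)
  then show ?thesis using that[of "max a b"] sph_space_mono[of a "max a b"] sph_space_mono[of b "max a b"] by auto
qed

lemma subspace_sph_polys: "subspace sph_polys"
proof (rule subspaceI)
  show "0 \<in> sph_polys" using sph_space_closed(4)[of 0] by (rule sph_polysI)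
  fix f g :: "real ^ 'n \<Rightarrow> real" and c assume f: "f \<in> sph_polys" 
  then show "c *\<^sub>R f \<in> sph_polys"
    using sph_space_closed(3) sph_polysI unfolding sph_polys_def by blast
  assume "g \<in> sph_polys"
  with f obtain L where "f \<in> sph_space L" "g \<in> sph_space L" by (rule sph_polys_common)
  then show "f + g \<in> sph_polys" by (meson sph_polysI sph_space_closed(1))
qed

lemma sph_polys_mult: "f \<in> sph_polys \<Longrightarrow> g \<in> sph_polys \<Longrightarrow> (\<lambda>x. f x * g x) \<in> sph_polys"
  using sph_space_mult sph_polysI unfolding sph_polys_def by blast

interpretation sph: inner_form "sph_polys :: (real ^ 'n::finite \<Rightarrow> real) set" sph_ip
proof
  fix f g h :: "real ^ 'n \<Rightarrow> real" and c :: real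
  assume f: "f \<in> sph_polys" 
  note c = sph_polys_continuous
  show "0 \<le> sph_ip f f"
    unfolding sph_ip_def using sphere_mean_mono[of "\<lambda>x. 0" "\<lambda>x. f x * f x"] c[OF f]
    by (simp add: sphere_mean_const continuous_on_mult)
  show "f = 0" if "sph_ip f f = 0"
  proof
    fix x show "f x = 0 x"
    proof (cases "x \<in> sphere 0 1")
      case True
      have "f x * f x = 0"
        by (rule sphere_mean_definite[OF _ _ that[unfolded sph_ip_def] True])
           (auto intro!: continuous_on_mult c[OF f])
      then show ?thesis by simp
    next
      case False
      then show ?thesis using f sph_space_zero by (auto simp: sph_polys_def)
    qed
  qed
  assume g: "g \<in> sph_polys"
  show "sph_ip f g = sph_ip g f" by (simp add: sph_ip_def mult.commute)
  show "sph_ip (c *\<^sub>R f) g = c * sph_ip f g"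
    unfolding sph_ip_def using sphere_mean_cmult[OF continuous_on_mult[OF c[OF f] c[OF g]]]
    by (simp add: scaleR_fun_apply mult.assoc)
  assume h: "h \<in> sph_polys"
  show "sph_ip (f + g) h = sph_ip f h + sph_ip g h"
    unfolding sph_ip_def
    using sphere_mean_add[OF continuous_on_mult[OF c[OF f] c[OF h]] continuous_on_mult[OF c[OF g] c[OF h]]]
    by (simp add: distrib_right)
qed (rule subspace_sph_polys)

definition sph_onb :: "nat \<Rightarrow> (real ^ 'n::finite \<Rightarrow> real) set \<Rightarrow> bool" where
  "sph_onb L U \<longleftrightarrow> sph.orthonormal U \<and> span U = sph_space L"

lemma sph_onb_card: "sph_onb L U \<Longrightarrow> card U = sph_dim TYPE('n::finite) L"
  for U :: "(real ^ 'n \<Rightarrow> real) set"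
  using sph_dim_eq_card sph.orthonormal_independent unfolding sph_onb_def by metis

lemma sph_onb_memb: "sph_onb L U \<Longrightarrow> u \<in> U \<Longrightarrow> u \<in> sph_space L"
  unfolding sph_onb_def using span_base by blast

lemma sph_onb_extend:
  fixes U :: "(real ^ 'n::finite \<Rightarrow> real) set"
  assumes U: "sph.orthonormal U" "U \<subseteq> sph_space L"
  shows "\<exists>W. sph_onb L W \<and> U \<subseteq> W"
proof -
  let ?G = "on_sphere ` {monomial_fun \<alpha> |\<alpha>. (\<Sum>i\<in>UNIV. \<alpha> i) \<le> L} :: (real ^ 'n \<Rightarrow> real) set"
  have G: "span ?G = sph_space L" by (rule sph_space_span[symmetric])
  have "?G \<subseteq> sph_space L" unfolding sph_space_span by (rule span_superset)
  then have "?G \<subseteq> sph_polys" by (auto intro: sph_polysI)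
  from sph.orthonormal_extend[OF U(1) finite_sph_generators this]
  obtain W where W: "sph.orthonormal W" "U \<subseteq> W" "span W = span (U \<union> ?G)"
    by (elim exE conjE)
  have "span (U \<union> ?G) = span ?G"
  proof (rule span_eq[THEN iffD2], intro conjI)
    show "U \<union> ?G \<subseteq> span ?G" using U(2) span_superset[of ?G] unfolding G by simp
    show "?G \<subseteq> span (U \<union> ?G)" using span_superset[of "U \<union> ?G"] by (simp only: Un_subset_iff)
  qed
  then show ?thesis using W G by (auto simp: sph_onb_def)
qed

lemma sph_onb_exists: "\<exists>U. sph_onb L U"
  using sph_onb_extend[of "{}" L] by (auto simp: sph.orthonormal_def)

definition kernel :: "(real ^ 'n::finite \<Rightarrow> real) set \<Rightarrow> real ^ 'n \<Rightarrow> real ^ 'n \<Rightarrow> real" where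
  "kernel U y x = (\<Sum>u\<in>U. u y * u x)"

lemma kernel_sum: "kernel U y = (\<Sum>u\<in>U. u y *\<^sub>R u)"
  by (intro ext) (simp add: kernel_def sum_fun_apply scaleR_fun_apply)

lemma kernel_in: "sph_onb L U \<Longrightarrow> kernel U y \<in> sph_space L"
  unfolding kernel_sum by (auto intro!: sph_space_closed sph_onb_memb)

lemma kernel_reproducing:
  assumes U: "sph_onb L U" and f: "f \<in> sph_space L"
  shows "sph_ip f (kernel U y) = f y"
proof -
  have f': "f \<in> span U" "f \<in> sph_polys" and U': "sph.orthonormal U" "U \<subseteq> sph_polys"
    using U f sph_polysI by (auto simp: sph_onb_def sph.orthonormal_def)
  have "sph_ip f (kernel U y) = (\<Sum>u\<in>U. u y * sph_ip f u)"
    unfolding kernel_sum using f' U' by (intro sph.ip_sum_right) auto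
  also have "\<dots> = (\<Sum>u\<in>U. sph_ip f u *\<^sub>R u) y"
    by (simp add: sum_fun_apply scaleR_fun_apply mult.commute)
  also have "\<dots> = f y" using sph.orthonormal_expansion[OF U'(1) f'(1)] by simp
  finally show ?thesis .
qed

text \<open>Transporting the kernel at one point by a rotation gives the kernel at the image point, so
  the diagonal is constant. Its mean is the number of basis functions.\<close>

lemma kernel_diagonal:
  fixes U :: "(real ^ 'n::finite \<Rightarrow> real) set"
  assumes U: "sph_onb L U" and x: "x \<in> sphere 0 1"
  shows "kernel U x x = sph_dim TYPE('n) L"
proof -
  have const: "kernel U y y = kernel U x x" if y: "y \<in> sphere 0 1" for y
  proof -
    obtain \<rho> where \<rho>: "orthogonal_transformation \<rho>" "\<rho> y = x"
      using orthogonal_transformation_exists_1[of y x] x y by auto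
    define \<rho>' where "\<rho>' = inv_into UNIV \<rho>"
    have \<rho>': "orthogonal_transformation \<rho>'" unfolding \<rho>'_def using \<rho>(1) by (rule orthogonal_transformation_inv)
    have bij: "bij \<rho>" using \<rho>(1) by (rule orthogonal_transformation_bij)
    have inv: "\<rho> (\<rho>' w) = w" "\<rho>' x = y" for w
      using bij \<rho>(2) unfolding \<rho>'_def by (auto simp: bij_is_surj surj_f_inv_f bij_is_inj inv_f_f)
    have a: "(\<lambda>w. kernel U x (\<rho> w)) \<in> sph_space L" and b: "(\<lambda>w. kernel U y (\<rho>' w)) \<in> sph_space L"
      using kernel_in[OF U] \<rho>(1) \<rho>' by (auto intro: sph_space_rotate)
    have "kernel U x x = sph_ip (\<lambda>w. kernel U x (\<rho> w)) (kernel U y)"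
      using kernel_reproducing[OF U a, of y] \<rho>(2) by simp
    also have "\<dots> = sphere_mean (\<lambda>w. kernel U x (\<rho> (\<rho>' w)) * kernel U y (\<rho>' w))"
      unfolding sph_ip_def
      by (rule sphere_mean_rotate[OF \<rho>', of "\<lambda>w. kernel U x (\<rho> w) * kernel U y w", symmetric])
         (intro continuous_on_mult sph_space_continuous[OF a] sph_space_continuous[OF kernel_in[OF U]])
    also have "\<dots> = sph_ip (\<lambda>w. kernel U y (\<rho>' w)) (kernel U x)"
      by (simp add: inv sph_ip_def mult.commute)
    also have "\<dots> = kernel U y y" using kernel_reproducing[OF U b, of x] inv by simp
    finally show ?thesis by simp
  qed
  \<comment> \<open>the constant is found by taking the mean of the diagonal\<close>
  have on: "sph.orthonormal U" using U by (simp add: sph_onb_def)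
  then have UV: "U \<subseteq> sph_polys" and fin: "finite U" by (auto simp: sph.orthonormal_def)
  have sm: "sphere_mean (\<lambda>w. \<Sum>u\<in>T. u w * u w) = (\<Sum>u\<in>T. sph_ip u u)"
    and ct: "continuous_on (sphere 0 1) (\<lambda>w. \<Sum>u\<in>T. u w * u w)" if "T \<subseteq> U" for T
  proof -
    have "finite T" using that fin finite_subset by blast
    then have "sphere_mean (\<lambda>w. \<Sum>u\<in>T. u w * u w) = (\<Sum>u\<in>T. sph_ip u u) \<and> continuous_on (sphere 0 1) (\<lambda>w. \<Sum>u\<in>T. u w * u w)"
      using that
    proof (induction T rule: finite_induct)
      case (insert u T)
      then have "continuous_on (sphere 0 1) (\<lambda>w. u w * u w)" using UV
        by (auto intro!: sph_polys_continuous sph_polys_mult)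
      then show ?case using insert sphere_mean_add[of "\<lambda>w. u w * u w" "\<lambda>w. \<Sum>u\<in>T. u w * u w"]
        by (auto simp: sph_ip_def intro!: continuous_on_add)
    qed (simp add: sphere_mean_const)
    then show "sphere_mean (\<lambda>w. \<Sum>u\<in>T. u w * u w) = (\<Sum>u\<in>T. sph_ip u u)"
      "continuous_on (sphere 0 1) (\<lambda>w. \<Sum>u\<in>T. u w * u w)" by auto
  qed
  have "kernel U x x = sphere_mean (\<lambda>w :: real ^ 'n. kernel U x x)" by (rule sphere_mean_const[symmetric])
  also have "\<dots> = sphere_mean (\<lambda>w. kernel U w w)" using const by (intro sphere_mean_cong) auto
  also have "\<dots> = (\<Sum>u\<in>U. sph_ip u u)" unfolding kernel_def using sm[of U] by simp
  also have "\<dots> = (\<Sum>u\<in>U. 1)" using on by (intro sum.cong) (auto simp: sph.orthonormal_def)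
  finally show ?thesis using sph_onb_card[OF U] by simp
qed

section \<open>Lagrange functions of Fekete points\<close>

text \<open>Evaluation at the points \<^term>\<open>p i\<close> reads off coefficients.\<close>

lemma biorthogonal_independent:
  fixes F :: "'i \<Rightarrow> 'a \<Rightarrow> real"
  assumes fin: "finite I" and bi: "\<And>i k. i \<in> I \<Longrightarrow> k \<in> I \<Longrightarrow> F i (p k) = (if i = k then 1 else 0)"
  shows "inj_on F I" "independent (F ` I)"
proof -
  show inj: "inj_on F I"
  proof (rule inj_onI)
    fix i k assume "i \<in> I" "k \<in> I" "F i = F k"
    then have "F i (p i) = F k (p i)" "F i (p i) = 1" using bi[of i i] by simp_all
    then show "i = k" using bi[OF \<open>k \<in> I\<close> \<open>i \<in> I\<close>] by (cases "k = i") simp_all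
  qed
  show "independent (F ` I)"
  proof (rule independent_if_scalars_zero)
    fix c v assume sum: "(\<Sum>v\<in>F ` I. c v *\<^sub>R v) = 0" and "v \<in> F ` I"
    then obtain k where k: "k \<in> I" "v = F k" by auto
    have "0 = (\<Sum>i\<in>I. c (F i) *\<^sub>R F i) (p k)" using sum by (simp add: sum.reindex[OF inj])
    also have "\<dots> = (\<Sum>i\<in>I. if i = k then c (F k) else 0)"
      unfolding sum_fun_apply using bi k by (intro sum.cong) (auto simp: scaleR_fun_apply)
    finally show "c v = 0" using k fin by simp
  qed (use fin in simp)
qed

lemma biorthogonal_spanning:
  fixes F :: "'i \<Rightarrow> 'a \<Rightarrow> real"
  assumes fin: "finite I" and bi: "\<And>i k. i \<in> I \<Longrightarrow> k \<in> I \<Longrightarrow> F i (p k) = (if i = k then 1 else 0)"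
    and B: "finite B" "card B \<le> card I" and F: "F ` I \<subseteq> span B" and g: "g \<in> span B"
  shows "g x = (\<Sum>i\<in>I. g (p i) * F i x)"
proof -
  have ind: "inj_on F I" "independent (F ` I)"
    by (rule biorthogonal_independent[of I F p], rule fin, rule bi, assumption+)+
  have "g \<in> span (F ` I)"
  proof (rule ccontr)
    assume no: "g \<notin> span (F ` I)"
    then have "independent (insert g (F ` I))" using ind independent_insert span_base by metis
    then have "card (insert g (F ` I)) \<le> card B"
      using independent_span_bound[OF B(1)] F g by auto
    moreover have "card (insert g (F ` I)) = Suc (card I)"
      using no fin ind span_superset[of "F ` I"] by (subst card_insert_disjoint) (auto simp: card_image)
    ultimately show False using B by simp
  qed
  then obtain c where c: "g = (\<Sum>v\<in>F ` I. c v *\<^sub>R v)" using fin by (auto simp: span_finite)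
  have gx: "g y = (\<Sum>i\<in>I. c (F i) * F i y)" for y
    unfolding c by (simp add: sum.reindex[OF ind(1)] sum_fun_apply scaleR_fun_apply)
  have "g (p k) = c (F k)" if "k \<in> I" for k
  proof -
    have "g (p k) = (\<Sum>i\<in>I. if i = k then c (F k) else 0)"
      unfolding gx using bi that by (intro sum.cong) auto
    then show ?thesis using that fin by simp
  qed
  then show ?thesis using gx by simp
qed

text \<open>A generalised Vandermonde determinant, on an arbitrary set and with the size as an argument of its own,
  so that one can induct on the size.\<close>

definition sample_det :: "nat \<Rightarrow> (nat \<Rightarrow> 'a \<Rightarrow> real) \<Rightarrow> (nat \<Rightarrow> 'a) \<Rightarrow> real" where
  "sample_det n Q x = Determinant.det (Matrix.mat n n (\<lambda>(i, j). Q i (x j)))"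

text \<open>Laplace expansion along column \<^term>\<open>j\<close>: as a function of its \<^term>\<open>j\<close>-th node, the determinant
  lies in the span of the \<^term>\<open>Q\<close>. The cofactor in the last corner is the determinant of the
  smaller system, which drives the induction for the nonvanishing of the determinant.\<close>

lemma sample_det_column:
  assumes "j < n"
  obtains c where "\<And>y. sample_det n Q (x(j := y)) = (\<Sum>i<n. c i * Q i y)"
    and "Suc j = n \<Longrightarrow> c j = sample_det j Q x"
proof
  let ?A = "\<lambda>y. Matrix.mat n n (\<lambda>(i, k). Q i ((x(j := y)) k))"
  let ?c = "\<lambda>i. cofactor (?A undefined) i j"
  have minor: "mat_delete (?A y) i j = mat_delete (?A undefined) i j" if "i < n" for i y
    by (rule eq_matI) (use that assms in \<open>auto simp: mat_delete_def\<close>)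
  show "sample_det n Q (x(j := y)) = (\<Sum>i<n. ?c i * Q i y)" for y
  proof -
    have "sample_det n Q (x(j := y)) = (\<Sum>i<n. ?A y $$ (i, j) * cofactor (?A y) i j)"
      unfolding sample_det_def using assms by (intro laplace_expansion_column[of _ n]) simp_all
    also have "\<dots> = (\<Sum>i<n. ?c i * Q i y)"
    proof (rule sum.cong)
      fix i assume "i \<in> {..<n}"
      then have i: "i < n" by simp
      have "cofactor (?A y) i j = ?c i" unfolding cofactor_def minor[OF i, of y] ..
      then show "?A y $$ (i, j) * cofactor (?A y) i j = ?c i * Q i y" using assms i by simp
    qed simp
    finally show ?thesis .
  qed
  show "?c j = sample_det j Q x" if "Suc j = n"
  proof -
    have "mat_delete (?A undefined) j j = Matrix.mat j j (\<lambda>(i, k). Q i (x k))"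
      by (rule eq_matI) (use that in \<open>auto simp: mat_delete_def\<close>)
    then show ?thesis by (simp add: cofactor_def sample_det_def)
  qed
qed

text \<open>If the nodes found for \<open>n\<close> functions could not be completed by another node, the expansion
  along the last column would be a linear relation between the functions, with the nonzero smaller
  determinant as a coefficient.\<close>

lemma sample_det_nonzero:
  fixes Q :: "nat \<Rightarrow> 'a \<Rightarrow> real"
  assumes "inj_on Q {..<n}" "independent (Q ` {..<n})" "\<And>i y. i < n \<Longrightarrow> y \<notin> S \<Longrightarrow> Q i y = 0"
  shows "\<exists>x. (\<forall>j<n. x j \<in> S) \<and> sample_det n Q x \<noteq> 0"
  using assms
proof (induction n)
  case 0
  then show ?case by (simp add: sample_det_def)
next
  case (Suc n)
  have "inj_on Q {..<n}" using Suc.prems(1) by (rule inj_on_subset) auto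
  moreover have "independent (Q ` {..<n})" using Suc.prems(2) by (rule independent_mono) auto
  ultimately obtain x where x: "\<forall>j<n. x j \<in> S" "sample_det n Q x \<noteq> 0"
    using Suc by (meson less_SucI)
  obtain c where c: "\<And>y. sample_det (Suc n) Q (x(n := y)) = (\<Sum>i<Suc n. c i * Q i y)"
    "c n = sample_det n Q x"
    using sample_det_column[of n "Suc n" Q x] by auto
  have "\<exists>y\<in>S. (\<Sum>i<Suc n. c i * Q i y) \<noteq> 0"
  proof (rule ccontr)
    assume "\<not> (\<exists>y\<in>S. (\<Sum>i<Suc n. c i * Q i y) \<noteq> 0)"
    then have zero: "(\<Sum>i<Suc n. c i * Q i y) = 0" for y
      using Suc.prems(3) by (cases "y \<in> S") (auto intro: sum.neutral)
    define u where "u v = c (the_inv_into {..<Suc n} Q v)" for v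
    have uQ: "u (Q i) = c i" if "i < Suc n" for i
      using that by (simp add: u_def the_inv_into_f_f[OF Suc.prems(1)])
    have "(\<Sum>v\<in>Q ` {..<Suc n}. u v *\<^sub>R v) = (\<Sum>i<Suc n. c i *\<^sub>R Q i)"
      by (subst sum.reindex[OF Suc.prems(1)]) (auto intro!: sum.cong simp: uQ)
    also have "\<dots> = 0"
      using zero by (intro ext) (simp only: sum_fun_apply scaleR_fun_apply real_scaleR_def zero_fun_apply)
    finally have "u (Q n) = 0"
      using independentD[OF Suc.prems(2), of "Q ` {..<Suc n}" u "Q n"] by auto
    then show False using uQ[of n] c(2) x(2) by simp
  qed
  then obtain y where "y \<in> S" "(\<Sum>i<Suc n. c i * Q i y) \<noteq> 0" by blast
  then show ?case using x c(1)[of y] by (intro exI[of _ "x(n := y)"]) (auto simp: less_Suc_eq simp del: fun_upd_apply sum.lessThan_Suc, auto)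
qed

text \<open>By Cramer's rule the Lagrange function of the node \<open>z j\<close> is the quotient of the determinant with
  that node replaced by \<open>x\<close> and the original one. Maximality of the determinant says precisely that
  this quotient is at most 1 in absolute value.\<close>

lemma fekete_lagrange:
  fixes z :: "nat \<Rightarrow> real ^ 'n::finite"
  assumes z: "fekete_points L z"
  defines "n \<equiv> sph_dim TYPE('n) L"
  obtains l where "\<And>j. j < n \<Longrightarrow> l j \<in> sph_space L"
    and "\<And>j x. j < n \<Longrightarrow> \<bar>l j x\<bar> \<le> 1"
    and "\<And>g x. g \<in> sph_space L \<Longrightarrow> g x = (\<Sum>j<n. g (z j) * l j x)"
proof -
  obtain Q where zS: "\<forall>j<n. z j \<in> sphere 0 1" and Q: "sph_basis L Q"
    and maxi: "\<And>x. \<forall>j<n. x j \<in> sphere 0 1 \<Longrightarrow> \<bar>sample_det n Q x\<bar> \<le> \<bar>sample_det n Q z\<bar>"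
    using z unfolding fekete_points_def vandermonde_def sample_det_def n_def by blast
  have inj: "inj_on Q {..<n}" and ind: "independent (Q ` {..<n})" and sp: "span (Q ` {..<n}) = sph_space L"
    using Q by (auto simp: sph_basis_def n_def)
  have Qin: "Q i \<in> sph_space L" if "i < n" for i
    unfolding sp[symmetric] using that by (intro span_base) auto
  have Q0: "Q i y = 0" if "i < n" "y \<notin> sphere 0 1" for i y
    using sph_space_zero[OF Qin that(2)] that by blast
  obtain x where "\<forall>j<n. x j \<in> sphere 0 1" "sample_det n Q x \<noteq> 0"
    using sample_det_nonzero[OF inj ind Q0] by blast
  then have D: "sample_det n Q z \<noteq> 0" using maxi[of x] by auto
  define l where "l j x = (if x \<in> sphere 0 1 then sample_det n Q (z(j := x)) / sample_det n Q z else 0)" for j x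
  have lin: "l j \<in> sph_space L" if j: "j < n" for j
  proof -
    obtain c where c: "\<And>y. sample_det n Q (z(j := y)) = (\<Sum>i<n. c i * Q i y)"
      using sample_det_column[OF j] by metis
    have "l j = (\<Sum>i<n. (c i / sample_det n Q z) *\<^sub>R Q i)"
    proof
      fix y show "l j y = (\<Sum>i<n. (c i / sample_det n Q z) *\<^sub>R Q i) y"
        using Q0 by (auto simp: l_def c sum_fun_apply scaleR_fun_apply sum_divide_distrib intro!: sum.neutral)
    qed
    then show ?thesis using Qin by (auto intro!: sph_space_closed)
  qed
  have bound: "\<bar>l j x\<bar> \<le> 1" if j: "j < n" for j x
    using maxi[of "z(j := x)"] zS D by (auto simp: l_def divide_le_eq_1)
  have bi: "l j (z k) = (if j = k then 1 else 0)" if jk: "j < n" "k < n" for j k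
  proof (cases "j = k")
    case True
    then show ?thesis using zS D jk by (simp add: l_def)
  next
    case False
    have "sample_det n Q (z(j := z k)) = 0"
      unfolding sample_det_def
      by (rule det_identical_columns[of _ n j k]) (use False jk in \<open>auto intro!: eq_vecI\<close>)
    then show ?thesis using False by (simp add: l_def)
  qed
  have "g x = (\<Sum>j<n. g (z j) * l j x)" if g: "g \<in> sph_space L" for g x
  proof (rule biorthogonal_spanning)
    show "card (Q ` {..<n}) \<le> card {..<n}" by (intro card_image_le) auto
  qed (use bi lin g sp in auto)
  with lin bound show ?thesis using that by blast
qed

section \<open>Growth of the dimension\<close>

lemma sph_space_basis:
  obtains B :: "(real ^ 'n::finite \<Rightarrow> real) set"
  where "finite B" "independent B" "span B = sph_space L" "card B = sph_dim TYPE('n) L"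
proof -
  let ?G = "on_sphere ` {monomial_fun \<alpha> |\<alpha>. (\<Sum>i\<in>UNIV. \<alpha> i) \<le> L} :: (real ^ 'n \<Rightarrow> real) set"
  obtain B where B: "B \<subseteq> ?G" "independent B" "?G \<subseteq> span B"
    using maximal_independent_subset[of ?G] by blast
  have "span B = sph_space L" unfolding sph_space_span
    using B by (intro span_eq[THEN iffD2]) (auto intro: span_base)
  moreover have "finite B" using B(1) finite_sph_generators by (rule finite_subset)
  ultimately show ?thesis using that B(2) sph_dim_eq_card[of B L] by simp
qed

lemma card_le_sph_dim:
  fixes U :: "(real ^ 'n::finite \<Rightarrow> real) set"
  assumes "independent U" "U \<subseteq> sph_space L"
  shows "card U \<le> sph_dim TYPE('n) L"
proof -
  obtain B :: "(real ^ 'n::finite \<Rightarrow> real) set"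
    where B: "finite B" "independent B" "span B = sph_space L" "card B = sph_dim TYPE('n) L"
    by (rule sph_space_basis)
  then show ?thesis using independent_span_bound[OF B(1) assms(1)] assms(2) by simp
qed

lemma sph_dim_pos: "0 < sph_dim TYPE('n::finite) L"
proof -
  have ne: "on_sphere (\<lambda>_ :: real ^ 'n. 1) \<noteq> 0"
  proof
    assume zero: "on_sphere (\<lambda>_ :: real ^ 'n. 1 :: real) = 0"
    obtain v :: "real ^ 'n" where "norm v = 1" using vector_choose_size[of 1] by auto
    then show False using fun_cong[OF zero, of v] by (simp add: on_sphere_def)
  qed
  have "card {on_sphere (\<lambda>_ :: real ^ 'n. 1 :: real)} \<le> sph_dim TYPE('n) L"
    using ne on_sphere_const by (intro card_le_sph_dim) auto
  then show ?thesis by simp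
qed

lemma sph_dim_mono: "L \<le> L' \<Longrightarrow> sph_dim TYPE('n::finite) L \<le> sph_dim TYPE('n) L'"
proof -
  assume "L \<le> L'"
  obtain B :: "(real ^ 'n::finite \<Rightarrow> real) set"
    where B: "finite B" "independent B" "span B = sph_space L" "card B = sph_dim TYPE('n) L"
    by (rule sph_space_basis)
  have "B \<subseteq> sph_space L'" using B(3) span_superset[of B] sph_space_mono[OF \<open>L \<le> L'\<close>] by blast
  then show ?thesis using card_le_sph_dim[OF B(2)] B(4) by metis
qed

lemma card_remove_index:
  assumes "CARD('n::finite) = d + 1"
  shows "card (UNIV - {i :: 'n}) = d"
  using assms by (simp add: card_Diff_singleton)

text \<open>In all coordinates but one, tensor products of one-variable Lagrange polynomials
  separate the points of a grid. The grid is so small that its points can be lifted to the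
  sphere by solving for the remaining coordinate.\<close>

lemma sph_dim_lower:
  assumes card: "CARD('n::finite) = d + 1"
  shows "(s + 1) ^ d \<le> sph_dim TYPE('n) (d * s)"
proof -
  define i0 :: 'n where "i0 = undefined"
  define I where "I = UNIV - {i0}"
  have cI: "card I = d" and fI: "finite I" unfolding I_def using card_remove_index[OF card] by auto
  define t where "t b = real b / (real (s + 1) * real (d + 1))" for b :: nat
  have t01: "0 \<le> t b" "t b \<le> 1 / real (d + 1)" if "b \<le> s" for b
  proof -
    show "0 \<le> t b" unfolding t_def by simp
    have "t b = (real b / real (s + 1)) * (1 / real (d + 1))" unfolding t_def by simp
    also have "\<dots> \<le> 1 * (1 / real (d + 1))" using that by (intro mult_right_mono) auto
    finally show "t b \<le> 1 / real (d + 1)" by simp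
  qed
  have tinj: "t b = t c \<longleftrightarrow> b = c" for b c unfolding t_def by simp
  define A where "A = PiE I (\<lambda>_. {..s})"
  have fA: "finite A" unfolding A_def using fI by (intro finite_PiE) auto
  have cA: "card A = (s + 1) ^ d" unfolding A_def using fI cI by (simp add: card_PiE)
  define P :: "('n \<Rightarrow> nat) \<Rightarrow> real ^ 'n" where
    "P a = (\<chi> i. if i = i0 then sqrt (1 - (\<Sum>j\<in>I. (t (a j))\<^sup>2)) else t (a i))" for a
  have PS: "P a \<in> sphere 0 1" if a: "a \<in> A" for a
  proof -
    have "(\<Sum>j\<in>I. (t (a j))\<^sup>2) \<le> (\<Sum>j\<in>I. (1 / real (d + 1)))"
    proof (rule sum_mono)
      fix j assume "j \<in> I"
      then have b: "a j \<le> s" using a by (auto simp: A_def PiE_iff)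
      have "(t (a j))\<^sup>2 \<le> (1 / real (d + 1))\<^sup>2" using t01[OF b] by (intro power_mono) auto
      also have "\<dots> \<le> 1 / real (d + 1)" using power_decreasing[of 1 2 "1 / real (d + 1)"] by simp
      finally show "(t (a j))\<^sup>2 \<le> 1 / real (d + 1)" .
    qed
    also have "\<dots> \<le> 1" using cI by (simp add: field_simps)
    finally have le: "(\<Sum>j\<in>I. (t (a j))\<^sup>2) \<le> 1" .
    have "(\<Sum>i\<in>UNIV. (vec_nth (P a) i)\<^sup>2) = (vec_nth (P a) i0)\<^sup>2 + (\<Sum>i\<in>I. (vec_nth (P a) i)\<^sup>2)"
      unfolding I_def by (rule sum.remove) auto
    also have "(\<Sum>i\<in>I. (vec_nth (P a) i)\<^sup>2) = (\<Sum>i\<in>I. (t (a i))\<^sup>2)"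
      by (intro sum.cong) (auto simp: P_def I_def)
    also have "(vec_nth (P a) i0)\<^sup>2 = 1 - (\<Sum>i\<in>I. (t (a i))\<^sup>2)"
      using le by (simp add: P_def)
    finally show ?thesis by (simp add: norm_vec_def L2_set_def)
  qed
  define F where "F a = on_sphere (\<lambda>x :: real ^ 'n. \<Prod>i\<in>I. \<Prod>b\<in>{..s} - {a i}. (vec_nth x i - t b) / (t (a i) - t b))" for a
  have FL: "F a \<in> sph_space (d * s)" if a: "a \<in> A" for a
  proof -
    have factor: "on_sphere (\<lambda>x :: real ^ 'n. (vec_nth x i - p) / q) \<in> sph_space 1" for i p q
    proof -
      have "on_sphere (\<lambda>x :: real ^ 'n. (- p / q) + (1 / q) * vec_nth x i) \<in> sph_space 1"
        using on_sphere_mult[OF on_sphere_const[of "1 / q" 0] on_sphere_coord[of i]]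
        by (intro on_sphere_add on_sphere_const) simp
      moreover have "(- p / q) + (1 / q) * vec_nth x i = (vec_nth x i - p) / q" for x :: "real ^ 'n"
        by (simp add: diff_divide_distrib)
      ultimately show ?thesis by simp
    qed
    have "F a \<in> sph_space (\<Sum>i\<in>I. \<Sum>b\<in>{..s} - {a i}. 1)"
      unfolding F_def by (intro on_sphere_prod factor)
    also have "(\<Sum>i\<in>I. \<Sum>b\<in>{..s} - {a i}. 1) = (\<Sum>i\<in>I. s)"
      using a by (intro sum.cong) (auto simp: A_def PiE_iff)
    finally show ?thesis by (simp add: cI)
  qed
  have bi: "F a (P a') = (if a = a' then 1 else 0)" if a: "a \<in> A" "a' \<in> A" for a a'
  proof -
    have FP: "F a (P a') = (\<Prod>i\<in>I. \<Prod>b\<in>{..s} - {a i}. (t (a' i) - t b) / (t (a i) - t b))"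
      using PS[OF a(2)] unfolding F_def on_sphere_def
      by (auto simp: P_def I_def intro!: prod.cong)
    show ?thesis
    proof (cases "a = a'")
      case True
      then show ?thesis unfolding FP by (auto simp: tinj intro!: prod.neutral)
    next
      case False
      then obtain i where i: "i \<in> I" "a i \<noteq> a' i" using a unfolding A_def by (metis PiE_ext)
      then have "a' i \<in> {..s} - {a i}" using a by (auto simp: A_def PiE_iff)
      then have "(\<Prod>b\<in>{..s} - {a i}. (t (a' i) - t b) / (t (a i) - t b)) = 0"
        by (intro prod_zero) (auto intro!: bexI[of _ "a' i"])
      then have "F a (P a') = 0" unfolding FP using fI i(1) by (intro prod_zero) auto
      then show ?thesis using False by simp
    qed
  qed
  have ind: "inj_on F A" "independent (F ` A)"
    by (rule biorthogonal_independent[of A F P], rule fA, rule bi, assumption+)+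
  have "card (F ` A) \<le> sph_dim TYPE('n) (d * s)"
    using ind(2) FL by (intro card_le_sph_dim) auto
  then show ?thesis using ind(1) cA by (simp add: card_image)
qed

text \<open>On the sphere the square of one distinguished coordinate is 1 minus the sum of the other
  squares. Hence, modulo lower degree, only the monomials of top degree in which the exponent of that
  coordinate is 0 or 1 are needed. Such an exponent vector is determined by the exponents of
  all but one of the other coordinates, which gives the power \<open>d - 1\<close>.\<close>

lemma sph_dim_Suc:
  assumes card: "CARD('n::finite) = d + 1" and d: "d \<ge> 1"
  shows "sph_dim TYPE('n) (Suc L) \<le> sph_dim TYPE('n) L + 2 * (L + 2) ^ (d - 1)"
proof -
  define i0 :: 'n where "i0 = undefined"
  define I where "I = UNIV - {i0}"
  have cI: "card I = d" and fI: "finite I" unfolding I_def using card_remove_index[OF card] by auto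
  then obtain i1 where i1: "i1 \<in> I" using d by fastforce
  define J where "J = I - {i1}"
  have cJ: "card J = d - 1" and fJ: "finite J" unfolding J_def using i1 cI by auto
  define As where "As = {\<alpha> :: 'n \<Rightarrow> nat. (\<Sum>i\<in>UNIV. \<alpha> i) = Suc L \<and> \<alpha> i0 \<le> 1}"
  have split: "(\<Sum>i\<in>UNIV. \<alpha> i) = \<alpha> i0 + (\<alpha> i1 + (\<Sum>i\<in>J. \<alpha> i))" for \<alpha> :: "'n \<Rightarrow> nat"
  proof -
    have "(\<Sum>i\<in>UNIV. \<alpha> i) = \<alpha> i0 + (\<Sum>i\<in>I. \<alpha> i)" unfolding I_def by (rule sum.remove) auto
    also have "(\<Sum>i\<in>I. \<alpha> i) = \<alpha> i1 + (\<Sum>i\<in>J. \<alpha> i)" unfolding J_def using fI i1 by (rule sum.remove)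
    finally show ?thesis .
  qed
  define T where "T = {..1::nat} \<times> PiE J (\<lambda>_. {..Suc L})"
  have fT: "finite T" unfolding T_def using fJ by (auto intro!: finite_PiE)
  have cT: "card T = 2 * (L + 2) ^ (d - 1)" unfolding T_def using fJ cJ by (simp add: card_cartesian_product card_PiE)
  \<comment> \<open>the exponent of \<open>i1\<close> is recovered from the total degree\<close>
  define r where "r \<alpha> = (\<alpha> i0, restrict \<alpha> J)" for \<alpha> :: "'n \<Rightarrow> nat"
  have inj: "inj_on r As"
  proof (rule inj_onI)
    fix \<alpha> \<beta> assume ab: "\<alpha> \<in> As" "\<beta> \<in> As" "r \<alpha> = r \<beta>"
    then have eJ: "\<alpha> i = \<beta> i" if "i \<in> J" for i
      using that unfolding r_def by (auto dest: fun_cong[of _ _ i] simp: restrict_def)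
    have e0: "\<alpha> i0 = \<beta> i0" using ab unfolding r_def by auto
    have "(\<Sum>i\<in>J. \<alpha> i) = (\<Sum>i\<in>J. \<beta> i)" using eJ by (intro sum.cong) auto
    then have "\<alpha> i1 = \<beta> i1" using split[of \<alpha>] split[of \<beta>] ab e0 by (auto simp: As_def)
    then show "\<alpha> = \<beta>"
    proof (intro ext)
      fix i show "\<alpha> i = \<beta> i" using \<open>\<alpha> i1 = \<beta> i1\<close> e0 eJ[of i] by (cases "i = i0 \<or> i = i1") (auto simp: J_def I_def)
    qed
  qed
  have sub: "r ` As \<subseteq> T"
  proof
    fix y assume "y \<in> r ` As"
    then obtain \<alpha> where \<alpha>: "\<alpha> \<in> As" "y = r \<alpha>" by auto
    have "\<alpha> i \<le> (\<Sum>i\<in>UNIV. \<alpha> i)" for i by (rule member_le_sum) auto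
    then have "\<alpha> i \<le> Suc L" for i using \<alpha>(1) by (simp add: As_def)
    then show "y \<in> T" using \<alpha> by (auto simp: T_def r_def As_def)
  qed
  have fAs: "finite As" using inj_on_finite[OF inj sub fT] .
  have cAs: "card As \<le> 2 * (L + 2) ^ (d - 1)" using card_inj_on_le[OF inj sub fT] cT by simp
  obtain B :: "(real ^ 'n::finite \<Rightarrow> real) set"
    where B: "finite B" "independent B" "span B = sph_space L" "card B = sph_dim TYPE('n) L"
    by (rule sph_space_basis)
  define G where "G = (\<lambda>\<alpha>. on_sphere (monomial_fun \<alpha>)) ` As"
  have BW: "sph_space L \<subseteq> span (B \<union> G)" using B(3) span_mono[of B "B \<union> G"] by auto
  have top: "on_sphere (monomial_fun \<alpha>) \<in> span (B \<union> G)" if "(\<Sum>i\<in>UNIV. \<alpha> i) = Suc L" for \<alpha> :: "'n \<Rightarrow> nat"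
    using that
  proof (induction "\<alpha> i0" arbitrary: \<alpha> rule: less_induct)
    case less
    show ?case
    proof (cases "\<alpha> i0 \<le> 1")
      case True
      then have "on_sphere (monomial_fun \<alpha>) \<in> G" using less by (auto simp: G_def As_def)
      then show ?thesis by (auto intro: span_base)
    next
      case False
      \<comment> \<open>trade the factor \<open>x\<^sub>i\<^sub>0\<^sup>2\<close> for the other coordinates\<close>
      define \<beta> where "\<beta> = \<alpha>(i0 := \<alpha> i0 - 2)"
      define \<gamma> where "\<gamma> j = \<beta>(j := \<beta> j + 2)" for j
      have bsum: "(\<Sum>i\<in>UNIV. \<beta> i) + 2 = Suc L"
      proof -
        have "(\<Sum>i\<in>I. \<beta> i) = (\<Sum>i\<in>I. \<alpha> i)" by (intro sum.cong) (auto simp: \<beta>_def I_def)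
        moreover have "(\<Sum>i\<in>UNIV. \<beta> i) = \<beta> i0 + (\<Sum>i\<in>I. \<beta> i)" "(\<Sum>i\<in>UNIV. \<alpha> i) = \<alpha> i0 + (\<Sum>i\<in>I. \<alpha> i)"
          unfolding I_def by (auto intro: sum.remove)
        ultimately show ?thesis using less(2) False by (simp add: \<beta>_def)
      qed
      have update: "monomial_fun (\<delta>(j := \<delta> j + 2)) x = monomial_fun \<delta> x * (vec_nth x j)\<^sup>2" for \<delta> :: "'n \<Rightarrow> nat" and j x
      proof -
        have "monomial_fun (\<delta>(j := \<delta> j + 2)) x = (\<Prod>i\<in>UNIV. vec_nth x i ^ \<delta> i * (if i = j then (vec_nth x j)\<^sup>2 else 1))"
          unfolding monomial_fun_def by (intro prod.cong) (auto simp: power_add power2_eq_square)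
        then show ?thesis by (simp add: prod.distrib monomial_fun_def)
      qed
      have "on_sphere (monomial_fun \<alpha>) = on_sphere (monomial_fun \<beta>) - (\<Sum>j\<in>I. on_sphere (monomial_fun (\<gamma> j)))"
      proof
        fix x :: "real ^ 'n"
        show "on_sphere (monomial_fun \<alpha>) x = (on_sphere (monomial_fun \<beta>) - (\<Sum>j\<in>I. on_sphere (monomial_fun (\<gamma> j)))) x"
        proof (cases "x \<in> sphere 0 1")
          case True
          then have "(\<Sum>i\<in>UNIV. (vec_nth x i)\<^sup>2) = 1" by (simp add: norm_vec_def L2_set_def)
          then have x0: "(vec_nth x i0)\<^sup>2 = 1 - (\<Sum>i\<in>I. (vec_nth x i)\<^sup>2)"
            unfolding I_def using sum.remove[of UNIV i0 "\<lambda>i. (vec_nth x i)\<^sup>2"] by simp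
          have "\<alpha> = \<beta>(i0 := \<beta> i0 + 2)" using False by (intro ext) (simp add: \<beta>_def, arith)
          then have "monomial_fun \<alpha> x = monomial_fun \<beta> x * (vec_nth x i0)\<^sup>2" using update[of \<beta> i0 x] by simp
          then show ?thesis using True
            by (simp add: on_sphere_def sum_fun_apply x0 \<gamma>_def update[of \<beta>, simplified] right_diff_distrib sum_distrib_left)
        qed (simp add: on_sphere_def sum_fun_apply)
      qed
      moreover have "on_sphere (monomial_fun \<beta>) \<in> span (B \<union> G)"
        using BW on_sphere_monomial[of \<beta> L] bsum by auto
      moreover have "on_sphere (monomial_fun (\<gamma> j)) \<in> span (B \<union> G)" if j: "j \<in> I" for j
      proof (rule less(1))
        show "\<gamma> j i0 < \<alpha> i0" using j False by (auto simp: \<gamma>_def \<beta>_def I_def)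
        have "(\<Sum>i\<in>UNIV. \<gamma> j i) = \<gamma> j j + (\<Sum>i\<in>UNIV - {j}. \<gamma> j i)" by (rule sum.remove) auto
        also have "(\<Sum>i\<in>UNIV - {j}. \<gamma> j i) = (\<Sum>i\<in>UNIV - {j}. \<beta> i)"
          by (intro sum.cong) (auto simp: \<gamma>_def)
        also have "\<gamma> j j + (\<Sum>i\<in>UNIV - {j}. \<beta> i) = (\<Sum>i\<in>UNIV. \<beta> i) + 2"
          using sum.remove[of UNIV j \<beta>] by (simp add: \<gamma>_def)
        finally show "(\<Sum>i\<in>UNIV. \<gamma> j i) = Suc L" using bsum by simp
      qed
      ultimately show ?thesis by (auto intro!: span_diff span_sum)
    qed
  qed
  have "sph_space (Suc L) \<subseteq> span (B \<union> G)"
    unfolding sph_space_span[of "Suc L"]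
  proof (intro span_minimal subspace_span subsetI)
    fix f :: "real ^ 'n \<Rightarrow> real" assume "f \<in> on_sphere ` {monomial_fun \<alpha> |\<alpha>. (\<Sum>i\<in>UNIV. \<alpha> i) \<le> Suc L}"
    then obtain \<alpha> where \<alpha>: "f = on_sphere (monomial_fun \<alpha>)" "(\<Sum>i\<in>UNIV. \<alpha> i) \<le> Suc L" by auto
    then show "f \<in> span (B \<union> G)"
      using top[of \<alpha>] on_sphere_monomial[of \<alpha> L] BW by (cases "(\<Sum>i\<in>UNIV. \<alpha> i) = Suc L") auto
  qed
  moreover obtain C :: "(real ^ 'n::finite \<Rightarrow> real) set"
    where C: "finite C" "independent C" "span C = sph_space (Suc L)" "card C = sph_dim TYPE('n) (Suc L)"
    by (rule sph_space_basis)
  moreover have fG: "finite G" unfolding G_def using fAs by simp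
  ultimately have "card C \<le> card (B \<union> G)"
    using independent_span_bound[of "B \<union> G" C] B(1) span_superset[of C] by auto
  also have "\<dots> \<le> card B + card G" by (rule card_Un_le)
  also have "card G \<le> card As" unfolding G_def by (rule card_image_le[OF fAs])
  finally show ?thesis using B(4) C(4) cAs by simp
qed

section \<open>The trace comparison\<close>

lemma sum_abs_mult_le:
  fixes a b :: "'i \<Rightarrow> real"
  shows "\<bar>\<Sum>i\<in>I. a i * b i\<bar> \<le> sqrt (\<Sum>i\<in>I. (a i)\<^sup>2) * sqrt (\<Sum>i\<in>I. (b i)\<^sup>2)"
proof -
  have "\<bar>\<Sum>i\<in>I. a i * b i\<bar> \<le> (\<Sum>i\<in>I. \<bar>a i\<bar> * \<bar>b i\<bar>)"
    using sum_abs[of "\<lambda>i. a i * b i" I] by (simp add: abs_mult)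
  also have "\<dots> \<le> L2_set a I * L2_set b I" by (rule L2_set_mult_ineq)
  finally show ?thesis by (simp add: L2_set_def)
qed

lemma sph_ip_le:
  assumes "f \<in> sph_polys" "g \<in> sph_polys" "\<And>x. x \<in> sphere 0 1 \<Longrightarrow> \<bar>f x\<bar> \<le> \<bar>g x\<bar>"
  shows "sph_ip f f \<le> sph_ip g g"
  unfolding sph_ip_def
  by (intro sphere_mean_mono continuous_on_mult sph_polys_continuous assms)
     (use assms(3) in \<open>auto intro: abs_le_square_iff[THEN iffD1, unfolded power2_eq_square]\<close>)

text \<open>One trace is computed in two ways. Both the mean and the sum over the Fekete points \<open>z j\<close> of degree \<open>N + m\<close> give
  an inner product on polynomials of degree \<open>N\<close>, and \<open>T\<close> is the compression of multiplication by \<open>f\<close>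
  with respect to the discrete one. Its trace is at most \<open>\<Sum> f (z j)\<close>. On polynomials of degree \<open>N - k\<close> it is
  multiplication by \<open>f\<close> itself, and computed in a basis orthonormal for the mean this part of the
  trace is \<open>\<pi> (N - k) * sphere_mean f\<close>. The square root bounds the remaining part of the trace.\<close>

lemma fekete_sum_lower:
  fixes z :: "nat \<Rightarrow> real ^ 'n::finite" and f :: "real ^ 'n \<Rightarrow> real"
  assumes z: "fekete_points (N + m) z"
    and k: "k \<le> m" "k \<le> N" and f: "f \<in> sph_space k"
    and f0: "\<And>x. x \<in> sphere 0 1 \<Longrightarrow> 0 \<le> f x" and fC: "\<And>x. x \<in> sphere 0 1 \<Longrightarrow> f x \<le> C"
  defines "\<pi> \<equiv> \<lambda>L. real (sph_dim TYPE('n) L)"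
  shows "\<pi> (N - k) * sphere_mean f - C * \<pi> (N + m) * sqrt ((\<pi> N - \<pi> (N - k)) / \<pi> m)
    \<le> (\<Sum>j<sph_dim TYPE('n) (N + m). f (z j))"
proof -
  define M where "M = N + m"
  define n where "n = sph_dim TYPE('n) M"
  define S where "S = sphere (0 :: real ^ 'n) 1"
  obtain l where lM: "\<And>j. j < n \<Longrightarrow> l j \<in> sph_space M"
    and l1: "\<And>j x. j < n \<Longrightarrow> \<bar>l j x\<bar> \<le> 1"
    and lagrange: "\<And>g x. g \<in> sph_space M \<Longrightarrow> g x = (\<Sum>j<n. g (z j) * l j x)"
    using fekete_lagrange[OF z] unfolding M_def n_def by metis
  have zS: "z j \<in> S" if "j < n" for j
    using z that unfolding fekete_points_def n_def M_def S_def by blast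
  have C0: "0 \<le> C"
  proof -
    obtain v :: "real ^ 'n" where "norm v = 1" using vector_choose_size[of 1] by auto
    then show ?thesis using f0[of v] fC[of v] by simp
  qed
  have NM: "sph_space N \<subseteq> (sph_space M :: (real ^ 'n \<Rightarrow> real) set)"
    by (rule sph_space_mono) (simp add: M_def)

  \<comment> \<open>definite, because the Lagrange functions recover a polynomial from its values at the \<open>z j\<close>\<close>
  define dp where "dp g h = (\<Sum>j<n. g (z j) * h (z j))" for g h :: "real ^ 'n \<Rightarrow> real"
  interpret disc: inner_form "sph_space M :: (real ^ 'n \<Rightarrow> real) set" dp
  proof
    show "subspace (sph_space M)" by (rule subspace_sph_space)
    fix g h w :: "real ^ 'n \<Rightarrow> real" and c :: real
    show "dp (g + h) w = dp g w + dp h w"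
      by (simp add: dp_def distrib_right sum.distrib)
    show "dp (c *\<^sub>R g) w = c * dp g w"
      by (simp add: dp_def scaleR_fun_apply sum_distrib_left mult.assoc)
    show "dp g h = dp h g" by (simp add: dp_def mult.commute)
    show "0 \<le> dp g g" by (simp add: dp_def sum_nonneg)
    assume g: "g \<in> sph_space M" and "dp g g = 0"
    then have "g (z j) = 0" if "j < n" for j
      using that by (simp add: dp_def sum_nonneg_eq_0_iff)
    then have "(\<Sum>j<n. g (z j) * l j x) = 0" for x by simp
    then show "g = 0" unfolding lagrange[OF g, symmetric] by (intro ext) simp
  qed

  \<comment> \<open>a basis of degree \<open>N\<close>, orthonormal for the mean, whose part \<open>U0\<close> spans degree \<open>N - k\<close>\<close>
  obtain U0 :: "(real ^ 'n \<Rightarrow> real) set" where U0: "sph_onb (N - k) U0" using sph_onb_exists by blast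
  have "U0 \<subseteq> sph_space N"
    using sph_onb_memb[OF U0] sph_space_mono[of "N - k" N] by auto
  then obtain U where U: "sph_onb N U" "U0 \<subseteq> U"
    using sph_onb_extend U0 unfolding sph_onb_def by blast
  define H where "H = U - U0"
  have onU: "sph.orthonormal U" using U by (simp add: sph_onb_def)
  have finU: "finite U" using onU by (simp add: sph.orthonormal_def)
  have UN: "u \<in> sph_space N" if "u \<in> U" for u using sph_onb_memb[OF U(1) that] .
  have cH: "real (card H) = \<pi> N - \<pi> (N - k)"
    using card_Diff_subset[OF finite_subset[OF U(2) finU] U(2)] card_mono[OF finU U(2)]
      sph_onb_card[OF U(1)] sph_onb_card[OF U0] by (simp add: H_def \<pi>_def)
  have diagH: "(\<Sum>u\<in>H. (u x)\<^sup>2) = real (card H)" if "x \<in> S" for x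
  proof -
    have "(\<Sum>u\<in>U. (u x)\<^sup>2) = (\<Sum>u\<in>H. (u x)\<^sup>2) + (\<Sum>u\<in>U0. (u x)\<^sup>2)"
      unfolding H_def using finU U(2) by (rule sum.subset_diff[rotated])
    then show ?thesis
      using kernel_diagonal[OF U(1), of x] kernel_diagonal[OF U0, of x] that cH
      by (simp add: kernel_def power2_eq_square S_def \<pi>_def)
  qed

  have "\<exists>W. disc.orthonormal W \<and> span W = sph_space N"
  proof -
    have "U \<subseteq> sph_space M" using UN NM by blast
    moreover have "disc.orthonormal {}" by (simp add: disc.orthonormal_def)
    ultimately obtain W where "disc.orthonormal W" "span W = span ({} \<union> U)"
      using disc.orthonormal_extend[of "{}" U] finU by blast
    then show ?thesis using U by (auto simp: sph_onb_def)
  qed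
  then obtain W where W: "disc.orthonormal W" "span W = sph_space N" by blast
  have WN: "w \<in> sph_space N" if "w \<in> W" for w using W(2) span_base[OF that] by simp
  have WM: "w \<in> sph_space M" if "w \<in> W" for w using WN[OF that] NM by blast
  have finW: "finite W" using W by (simp add: disc.orthonormal_def)

  define F where "F g = (\<lambda>x. f x * g x)" for g :: "real ^ 'n \<Rightarrow> real"
  have FM: "F g \<in> sph_space M" if "g \<in> sph_space N" for g
  proof -
    have "F g \<in> sph_space (k + N)" unfolding F_def using f that by (rule sph_space_mult)
    then show ?thesis using sph_space_mono[of "k + N" M] k by (auto simp: M_def)
  qed
  define T where "T g = (\<Sum>w\<in>W. dp (F g) w *\<^sub>R w)" for g
  have TN: "T g \<in> sph_space N" for g
    unfolding T_def by (intro sph_space_closed(5,3) WN)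

  \<comment> \<open>the reproducing kernel of the discrete form is at most 1 on the diagonal at a node of mass 1\<close>
  have bessel_point: "(\<Sum>w\<in>W. (w (z j))\<^sup>2) \<le> 1" if j: "j < n" for j
  proof -
    define t where "t = (\<Sum>w\<in>W. (w (z j))\<^sup>2)"
    define s where "s = (\<Sum>w\<in>W. w (z j) *\<^sub>R w)"
    have sW: "s \<in> span W" unfolding s_def by (intro span_sum span_scale span_base)
    have "s \<in> sph_space M" using sW W(2) NM by blast
    moreover have "dp s w = w (z j)" if "w \<in> W" for w
      unfolding s_def by (rule disc.ip_orthonormal_sum[OF W(1) that])
    ultimately have ss: "dp s s = t"
      using disc.orthonormal_parseval[OF W(1) _ sW, of s] by (simp add: t_def power2_eq_square)
    have "s (z j) = t"
      by (simp add: s_def t_def sum_fun_apply scaleR_fun_apply power2_eq_square)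
    then have "t * t \<le> dp s s" unfolding dp_def
      using member_le_sum[of j "{..<n}" "\<lambda>j. s (z j) * s (z j)"] j by simp
    then have "t * t \<le> t * 1" using ss by simp
    then show ?thesis unfolding t_def[symmetric] by (cases "t > 0") auto
  qed

  \<comment> \<open>the trace of \<open>T\<close> in the two bases\<close>
  have "(\<Sum>u\<in>U. sph_ip (T u) u) = (\<Sum>w\<in>W. dp (F w) w)"
  proof -
    have UP: "u \<in> sph_polys" if "u \<in> U" for u using UN[OF that] by (rule sph_polysI)
    have WP: "w \<in> sph_polys" if "w \<in> W" for w using WN[OF that] by (rule sph_polysI)
    have "(\<Sum>u\<in>U. sph_ip (T u) u) = (\<Sum>u\<in>U. \<Sum>w\<in>W. dp (F u) w * sph_ip w u)"
      unfolding T_def using UP WP by (intro sum.cong sph.ip_sum_left) auto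
    also have "\<dots> = (\<Sum>w\<in>W. \<Sum>u\<in>U. dp (F u) w * sph_ip w u)" by (rule sum.swap)
    also have "\<dots> = (\<Sum>w\<in>W. dp (F w) w)"
    proof (rule sum.cong)
      fix w assume w: "w \<in> W"
      have wU: "w \<in> span U" using WN[OF w] U by (simp add: sph_onb_def)
      have "w x = (\<Sum>u\<in>U. sph_ip w u * u x)" for x
        using fun_cong[OF sph.orthonormal_expansion[OF onU wU], of x]
        by (simp only: sum_fun_apply scaleR_fun_apply real_scaleR_def)
      then have "dp (F w) w = (\<Sum>j<n. f (z j) * (\<Sum>u\<in>U. sph_ip w u * u (z j)) * w (z j))"
        unfolding dp_def F_def by (intro sum.cong refl arg_cong2[where f="(*)"])
      also have "\<dots> = (\<Sum>u\<in>U. dp (F u) w * sph_ip w u)"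
        unfolding dp_def F_def sum_distrib_left sum_distrib_right
        by (subst sum.swap) (simp add: mult_ac)
      finally show "(\<Sum>u\<in>U. dp (F u) w * sph_ip w u) = dp (F w) w" ..
    qed simp
    finally show ?thesis .
  qed
  also have "\<dots> = (\<Sum>j<n. f (z j) * (\<Sum>w\<in>W. (w (z j))\<^sup>2))"
    unfolding dp_def F_def sum_distrib_left by (subst sum.swap) (simp add: power2_eq_square mult_ac)
  also have "\<dots> \<le> (\<Sum>j<n. f (z j) * 1)"
    using f0 zS bessel_point by (intro sum_mono mult_left_mono) (auto simp: S_def)
  finally have upper: "(\<Sum>u\<in>U. sph_ip (T u) u) \<le> (\<Sum>j<n. f (z j))" by simp

  \<comment> \<open>\<open>f u\<close> still has degree at most \<open>N\<close> for \<open>u\<close> in \<open>U0\<close>, so the compression does not change it\<close>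
  have low: "(\<Sum>u\<in>U0. sph_ip (T u) u) = \<pi> (N - k) * sphere_mean f"
  proof -
    have Tu: "T u = F u" if u: "u \<in> U0" for u
    proof -
      have "F u \<in> sph_space (k + (N - k))"
        unfolding F_def using f sph_onb_memb[OF U0 u] by (rule sph_space_mult)
      then have "F u \<in> span W" using k W(2) by simp
      then show ?thesis unfolding T_def by (rule disc.orthonormal_expansion[OF W(1), symmetric])
    qed
    have U0P: "u \<in> sph_polys" if "u \<in> U0" for u using sph_onb_memb[OF U0 that] by (rule sph_polysI)
    have "(\<Sum>u\<in>U0. sph_ip (T u) u) = (\<Sum>u\<in>U0. sph_ip (\<lambda>x. u x * u x) f)"
      using Tu by (intro sum.cong) (auto simp: sph_ip_def F_def mult_ac)
    also have "\<dots> = sph_ip (\<Sum>u\<in>U0. 1 *\<^sub>R (\<lambda>x. u x * u x)) f"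
      using U0P f by (subst sph.ip_sum_left) (auto intro: sph_polys_mult sph_polysI)
    also have "\<dots> = sphere_mean (\<lambda>x. kernel U0 x x * f x)"
      by (simp add: sph_ip_def kernel_def sum_fun_apply)
    also have "\<dots> = sphere_mean (\<lambda>x. \<pi> (N - k) * f x)"
      using kernel_diagonal[OF U0] sph_space_continuous[OF f]
      by (intro sphere_mean_cong[symmetric]) (auto simp: \<pi>_def intro!: continuous_intros)
    also have "\<dots> = \<pi> (N - k) * sphere_mean f"
      by (rule sphere_mean_cmult[OF sph_space_continuous[OF f]])
    finally show ?thesis .
  qed

  \<comment> \<open>\<open>p y\<close> has degree \<open>m\<close>, the value 1 at \<open>y\<close> and the small square mean \<open>1 / \<pi> m\<close>\<close>
  obtain V :: "(real ^ 'n \<Rightarrow> real) set" where V: "sph_onb m V" using sph_onb_exists by blast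
  have \<pi>m: "\<pi> m > 0" using sph_dim_pos[where 'n='n and L=m] by (simp add: \<pi>_def)
  define p where "p y = (1 / \<pi> m) *\<^sub>R kernel V y" for y
  have pm: "p y \<in> sph_space m" for y unfolding p_def by (intro sph_space_closed kernel_in[OF V])
  have p1: "p y y = 1" if "y \<in> S" for y
    using kernel_diagonal[OF V, of y] that \<pi>m by (simp add: p_def scaleR_fun_apply \<pi>_def S_def)
  have psym: "p y x = p x y" for x y by (simp add: p_def scaleR_fun_apply kernel_def mult.commute)
  have pp: "sph_ip (p y) (p y) = 1 / \<pi> m" if y: "y \<in> S" for y
  proof -
    have "sph_ip (p y) (p y) = (1 / \<pi> m) * sph_ip (p y) (kernel V y)"
      unfolding p_def[of y] sph_ip_def scaleR_fun_apply real_scaleR_def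
      using sphere_mean_cmult[OF continuous_on_mult[OF sph_space_continuous[OF pm[of y]] sph_space_continuous[OF kernel_in[OF V, of y]]], of "1 / \<pi> m"]
      by (simp add: p_def scaleR_fun_apply mult_ac)
    then show ?thesis using kernel_reproducing[OF V pm] p1[OF y] by simp
  qed
  define q where "q j = (\<lambda>x. p (z j) x * l j x)" for j
  have qP: "q j \<in> sph_polys" if "j < n" for j
    unfolding q_def by (intro sph_polysI[OF sph_space_mult[OF pm lM[OF that]]])
  \<comment> \<open>Lagrange interpolation of \<open>g * p x\<close>, of degree \<open>N + m\<close>, evaluated at \<open>x\<close>\<close>
  have local_expansion: "g = (\<Sum>j<n. g (z j) *\<^sub>R q j)" if g: "g \<in> sph_space N" for g
  proof
    fix x
    show "g x = (\<Sum>j<n. g (z j) *\<^sub>R q j) x"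
    proof (cases "x \<in> S")
      case True
      have "(\<lambda>y. g y * p x y) \<in> sph_space M" unfolding M_def using g pm by (rule sph_space_mult)
      then have "g x * p x x = (\<Sum>j<n. (g (z j) * p x (z j)) * l j x)" by (rule lagrange)
      then have "g x = (\<Sum>j<n. (g (z j) * p x (z j)) * l j x)" using p1[OF True] by simp
      also have "\<dots> = (\<Sum>j<n. g (z j) * q j x)"
      proof (rule sum.cong)
        fix j
        show "g (z j) * p x (z j) * l j x = g (z j) * q j x"
          unfolding q_def psym[of x "z j"] by simp
      qed simp
      finally show ?thesis by (simp only: sum_fun_apply scaleR_fun_apply real_scaleR_def)
    next
      case False
      then have x: "x \<notin> sphere 0 1" by (simp add: S_def)
      show ?thesis
        using sph_space_zero[OF g x] sph_space_zero[OF pm x]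
        by (simp add: sum_fun_apply scaleR_fun_apply q_def sum.neutral)
    qed
  qed

  \<comment> \<open>Cauchy-Schwarz over pairs of a basis function and a node; \<open>T\<close> has norm at most \<open>C\<close> for the discrete form,
    and replacing \<open>q j\<close> by \<open>p (z j)\<close> in the second factor is where \<open>\<bar>l j\<bar> \<le> 1\<close> enters\<close>
  have rest: "\<bar>\<Sum>u\<in>H. sph_ip (T u) u\<bar> \<le> C * \<pi> M * sqrt (real (card H) / \<pi> m)"
  proof -
    have finH: "finite H" and HU: "H \<subseteq> U" using finU by (auto simp: H_def)
    have HP: "u \<in> sph_polys" if "u \<in> H" for u using UN HU that sph_polysI by blast
    have "(\<Sum>u\<in>H. sph_ip (T u) u) = (\<Sum>u\<in>H. \<Sum>j<n. T u (z j) * sph_ip (q j) u)"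
    proof (rule sum.cong)
      fix u assume "u \<in> H"
      then show "sph_ip (T u) u = (\<Sum>j<n. T u (z j) * sph_ip (q j) u)"
        using sph.ip_sum_left[of "{..<n}" q u "\<lambda>j. T u (z j)"] qP HP local_expansion[OF TN, of u] by simp
    qed simp
    also have "\<dots> = (\<Sum>(u, j)\<in>H \<times> {..<n}. T u (z j) * sph_ip (q j) u)"
      by (rule sum.cartesian_product)
    finally have eq: "(\<Sum>u\<in>H. sph_ip (T u) u) = (\<Sum>i\<in>H \<times> {..<n}. T (fst i) (z (snd i)) * sph_ip (q (snd i)) (fst i))"
      by (simp add: case_prod_beta)
    have "(\<Sum>i\<in>H \<times> {..<n}. (T (fst i) (z (snd i)))\<^sup>2) = (\<Sum>u\<in>H. dp (T u) (T u))"
      unfolding dp_def sum.cartesian_product by (simp add: case_prod_beta power2_eq_square)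
    also have "\<dots> \<le> (\<Sum>u\<in>H. dp (F u) (F u))"
    proof (rule sum_mono)
      fix u assume u: "u \<in> H"
      then have FuM: "F u \<in> sph_space M" using FM UN HU by blast
      have Tspan: "T u \<in> span W" unfolding T_def by (intro span_sum span_scale span_base)
      have TM: "T u \<in> sph_space M" using TN NM by blast
      have "dp (T u) w = dp (F u) w" if "w \<in> W" for w
        unfolding T_def by (rule disc.ip_orthonormal_sum[OF W(1) that])
      then have "dp (T u) (T u) = (\<Sum>w\<in>W. (dp (F u) w)\<^sup>2)"
        using disc.orthonormal_parseval[OF W(1) TM Tspan] by (simp add: power2_eq_square)
      also have "\<dots> \<le> dp (F u) (F u)" by (rule disc.bessel[OF W(1) FuM])
      finally show "dp (T u) (T u) \<le> dp (F u) (F u)" .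
    qed
    also have "\<dots> = (\<Sum>j<n. (f (z j))\<^sup>2 * (\<Sum>u\<in>H. (u (z j))\<^sup>2))"
      unfolding dp_def F_def sum_distrib_left by (subst sum.swap) (simp add: power2_eq_square mult_ac)
    also have "\<dots> \<le> (\<Sum>j<n. C\<^sup>2 * real (card H))"
      using zS f0 fC diagH by (intro sum_mono mult_mono power_mono) (auto simp: S_def)
    finally have a: "(\<Sum>i\<in>H \<times> {..<n}. (T (fst i) (z (snd i)))\<^sup>2) \<le> C\<^sup>2 * (\<pi> M * real (card H))"
      by (simp add: n_def \<pi>_def mult_ac)
    have "(\<Sum>i\<in>H \<times> {..<n}. (sph_ip (q (snd i)) (fst i))\<^sup>2) = (\<Sum>u\<in>H. \<Sum>j<n. (sph_ip (q j) u)\<^sup>2)"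
      unfolding sum.cartesian_product by (simp add: case_prod_beta)
    also have "\<dots> = (\<Sum>j<n. \<Sum>u\<in>H. (sph_ip (q j) u)\<^sup>2)" by (rule sum.swap)
    also have "\<dots> \<le> (\<Sum>j<n. 1 / \<pi> m)"
    proof (rule sum_mono)
      fix j assume "j \<in> {..<n}"
      then have j: "j < n" by simp
      have "(\<Sum>u\<in>H. (sph_ip (q j) u)\<^sup>2) \<le> sph_ip (q j) (q j)"
        by (rule sph.bessel[OF sph.orthonormal_subset[OF onU HU] qP[OF j]])
      also have "\<dots> \<le> sph_ip (p (z j)) (p (z j))"
        using l1[OF j] by (intro sph_ip_le qP[OF j] sph_polysI[OF pm]) (simp add: q_def abs_mult mult_left_le)
      also have "\<dots> = 1 / \<pi> m" using zS[OF j] by (rule pp)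
      finally show "(\<Sum>u\<in>H. (sph_ip (q j) u)\<^sup>2) \<le> 1 / \<pi> m" .
    qed
    finally have b: "(\<Sum>i\<in>H \<times> {..<n}. (sph_ip (q (snd i)) (fst i))\<^sup>2) \<le> \<pi> M / \<pi> m"
      by (simp add: n_def \<pi>_def)
    have "\<bar>\<Sum>u\<in>H. sph_ip (T u) u\<bar> \<le> sqrt (C\<^sup>2 * (\<pi> M * real (card H))) * sqrt (\<pi> M / \<pi> m)"
      unfolding eq using sum_abs_mult_le
      by (rule order_trans) (intro mult_mono real_sqrt_le_mono a b; simp add: sum_nonneg \<pi>_def)
    also have "\<dots> = sqrt ((C * \<pi> M)\<^sup>2 * (real (card H) / \<pi> m))"
      by (simp add: real_sqrt_mult[symmetric] power2_eq_square mult_ac)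
    also have "\<dots> = C * \<pi> M * sqrt (real (card H) / \<pi> m)"
      unfolding real_sqrt_mult real_sqrt_abs using C0 by (simp add: \<pi>_def)
    finally show ?thesis .
  qed
  have "(\<Sum>u\<in>U. sph_ip (T u) u) = (\<Sum>u\<in>H. sph_ip (T u) u) + (\<Sum>u\<in>U0. sph_ip (T u) u)"
    unfolding H_def using finU U(2) by (rule sum.subset_diff[rotated])
  then show ?thesis using upper low rest unfolding cH M_def n_def by linarith
qed

section \<open>The limit\<close>

lemma sph_dim_add:
  assumes card: "CARD('n::finite) = d + 1" and d: "d \<ge> 1"
  shows "sph_dim TYPE('n) (L + k) \<le> sph_dim TYPE('n) L + k * (2 * (L + k + 1) ^ (d - 1))"
proof (induction k)
  case (Suc k)
  have "sph_dim TYPE('n) (L + Suc k) \<le> sph_dim TYPE('n) (L + k) + 2 * (L + k + 2) ^ (d - 1)"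
    using sph_dim_Suc[OF card d, of "L + k"] by simp
  also have "sph_dim TYPE('n) (L + k) \<le> sph_dim TYPE('n) L + k * (2 * (L + k + 1) ^ (d - 1))"
    by (rule Suc.IH)
  also have "(L + k + 1) ^ (d - 1) \<le> (L + k + 2) ^ (d - 1)" by (intro power_mono) auto
  finally show ?case by (simp add: algebra_simps)
qed simp

lemma sph_dim_growth:
  assumes card: "CARD('n::finite) = d + 1"
  shows "(real L / real d) ^ d \<le> real (sph_dim TYPE('n) L)"
proof -
  have "real L / real d \<le> real (L div d + 1)"
  proof (cases "d = 0")
    case False
    then have "L \<le> (L div d) * d + d"
      using div_mult_mod_eq[of L d] mod_less_divisor[of d L] by linarith
    then have "L \<le> (L div d + 1) * d" by simp
    then have "real L \<le> real (L div d + 1) * real d" by (metis of_nat_le_iff of_nat_mult)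
    then show ?thesis using False by (simp add: divide_le_eq)
  qed simp
  then have "(real L / real d) ^ d \<le> real (L div d + 1) ^ d" by (intro power_mono) auto
  also have "\<dots> \<le> real (sph_dim TYPE('n) (d * (L div d)))"
    using sph_dim_lower[OF card, of "L div d"] by (metis of_nat_le_iff of_nat_power)
  also have "\<dots> \<le> real (sph_dim TYPE('n) L)" using sph_dim_mono[of "d * (L div d)" L] by simp
  finally show ?thesis .
qed

text \<open>Apply the trace comparison to \<open>M = N + m\<close> with \<open>m = M div q\<close>. Passing from \<open>\<pi> M\<close> to \<open>\<pi> (N - k)\<close> loses a
  fraction of order \<open>1 / q + k / M\<close>. The quotient under the square root is of order \<open>1 / M\<close> once \<open>q\<close> is fixed, as its
  numerator has order \<open>M\<^sup>d\<^sup>-\<^sup>1\<close> and its denominator order \<open>M\<^sup>d\<close>.\<close>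

lemma fekete_average_lower:
  fixes z :: "nat \<Rightarrow> nat \<Rightarrow> real ^ 'n::finite" and f :: "real ^ 'n \<Rightarrow> real"
  assumes card: "CARD('n) = d + 1" and d: "d \<ge> 1"
    and z: "\<And>L. fekete_points L (z L)" and f: "f \<in> sph_space k"
    and f0: "\<And>x. x \<in> sphere 0 1 \<Longrightarrow> 0 \<le> f x" and fC: "\<And>x. x \<in> sphere 0 1 \<Longrightarrow> f x \<le> C"
    and e: "e > 0"
  defines "\<pi> \<equiv> \<lambda>L. sph_dim TYPE('n) L"
  shows "eventually (\<lambda>M. sphere_mean f - e \<le> (1 / real (\<pi> M)) * (\<Sum>j<\<pi> M. f (z M j))) sequentially"
proof -
  define E where "E = sphere_mean f"
  have fc: "continuous_on (sphere 0 1) f" using f by (rule sph_space_continuous)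
  have E0: "0 \<le> E" unfolding E_def using sphere_mean_mono[of "\<lambda>_. 0" f] f0 fc by (simp add: sphere_mean_const)
  have C0: "0 \<le> C"
  proof -
    obtain v :: "real ^ 'n" where "norm v = 1" using vector_choose_size[of 1] by auto
    then show ?thesis using f0[of v] fC[of v] by simp
  qed
  have \<pi>0: "real (\<pi> L) > 0" for L unfolding \<pi>_def using sph_dim_pos by simp
  define A where "A = 2 * 2 ^ (d - 1) * real d ^ d"
  have A0: "A > 0" using d by (simp add: A_def)
  have Mpow: "2 * real (M + 1) ^ (d - 1) \<le> A / real d ^ d * real M ^ (d - 1)" if "M \<ge> 1" for M
  proof -
    have "real (M + 1) ^ (d - 1) \<le> (2 * real M) ^ (d - 1)" using that by (intro power_mono) auto
    then show ?thesis using d by (simp add: A_def power_mult_distrib)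
  qed
  have growth: "real M ^ d / real d ^ d \<le> real (\<pi> M)" for M
    using sph_dim_growth[OF card, of M] unfolding \<pi>_def power_divide .
  have Msplit: "real M ^ d = real M * real M ^ (d - 1)" for M using d by (cases d) auto

  \<comment> \<open>\<open>q\<close> makes the loss \<open>A E / q\<close> at most \<open>e / 2\<close>; it is at least 2 so that \<open>N\<close> is at least half of \<open>M\<close>\<close>
  define q where "q = nat \<lceil>2 * (A * E) / e\<rceil> + 2"
  have q1: "q \<ge> 2" by (simp add: q_def)
  have qe: "A * E / real q \<le> e / 2"
  proof -
    have "2 * (A * E) / e \<le> real q" unfolding q_def by linarith
    then show ?thesis using e q1 by (simp add: field_simps)
  qed
  define D where "D = real k * A * (2 * real q) ^ d"
  have lim: "((\<lambda>M. A * E * (real k / real M) + C * sqrt (D / real M)) \<longlongrightarrow> A * E * 0 + C * sqrt 0) sequentially"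
    by (intro tendsto_intros tendsto_divide_0[OF tendsto_const] filterlim_real_sequentially
          filterlim_at_top_imp_at_infinity)
  then have "eventually (\<lambda>M. A * E * (real k / real M) + C * sqrt (D / real M) < e / 2) sequentially"
    using e by (intro order_tendstoD) auto
  moreover have "eventually (\<lambda>M. M \<ge> 2 * q * (k + 1) + 2 * k + 2) sequentially" by (rule eventually_ge_at_top)
  ultimately show ?thesis
  proof eventually_elim
    case (elim M)
    define m where "m = M div q"
    define N where "N = M - m"
    have M1: "M \<ge> 1" using elim by simp
    have mq: "real m \<le> real M / real q" unfolding m_def by (rule of_nat_div_le_of_nat)
    have km: "k + 1 \<le> m"
    proof -
      have "(k + 1) * q \<le> M" using elim(2) by (simp add: algebra_simps)
      then show ?thesis unfolding m_def using q1 by (simp add: less_eq_div_iff_mult_less_eq)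
    qed
    have m_lower: "real M \<le> 2 * real q * real m"
    proof -
      have "M \<le> q * m + q" unfolding m_def
        using mult_div_mod_eq[of q M] mod_less_divisor[of q M] q1 by linarith
      also have "\<dots> \<le> q * m + q * m" using km by (cases m) auto
      finally have "M \<le> 2 * q * m" by simp
      then show ?thesis by (metis of_nat_le_iff of_nat_mult of_nat_numeral)
    qed
    have mM: "2 * m \<le> M" unfolding m_def using q1
      by (metis div_le_mono2 div_times_less_eq_dividend le_trans mult.commute mult_le_mono2 pos2)
    have NM: "N + m = M" "k \<le> N" "k \<le> m" using mM km elim(2) by (auto simp: N_def)
    define B where "B = 2 * real (M + 1) ^ (d - 1)"
    have B: "B \<le> A * real (\<pi> M) / real M"
    proof -
      have "B * real M \<le> A / real d ^ d * real M ^ (d - 1) * real M"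
        unfolding B_def using Mpow[OF M1] by (rule mult_right_mono) simp
      also have "\<dots> = A * (real M ^ d / real d ^ d)" by (simp add: Msplit)
      also have "\<dots> \<le> A * real (\<pi> M)" using growth A0 by (intro mult_left_mono) auto
      finally show ?thesis using M1 by (simp add: field_simps)
    qed
    have main: "real (\<pi> (N - k)) * E - C * real (\<pi> M) * sqrt ((real (\<pi> N) - real (\<pi> (N - k))) / real (\<pi> m))
        \<le> (\<Sum>j<\<pi> M. f (z M j))"
      unfolding \<pi>_def E_def using fekete_sum_lower[of N m "z M" k f C] z[of M] NM f f0 fC by simp
    have first: "real (\<pi> M) * (E - A * E / real q - A * E * (real k / real M)) \<le> real (\<pi> (N - k)) * E"
    proof -
      have "\<pi> M \<le> \<pi> (N - k) + (m + k) * (2 * (M + 1) ^ (d - 1))"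
        using sph_dim_add[OF card d, of "N - k" "m + k"] NM unfolding \<pi>_def by (simp add: algebra_simps)
      then have "real (\<pi> M) \<le> real (\<pi> (N - k) + (m + k) * (2 * (M + 1) ^ (d - 1)))"
        by (rule of_nat_mono)
      then have "real (\<pi> M) \<le> real (\<pi> (N - k)) + (real m + real k) * B"
        by (simp add: B_def)
      also have "(real m + real k) * B \<le> (real M / real q + real k) * (A * real (\<pi> M) / real M)"
        using mq B by (intro mult_mono) (auto simp: B_def)
      also have "\<dots> = real (\<pi> M) * (A / real q + A * (real k / real M))"
        using M1 q1 by (simp add: field_simps)
      finally have "real (\<pi> M) * (1 - A / real q - A * (real k / real M)) \<le> real (\<pi> (N - k))"
        by (simp add: algebra_simps)
      then have "real (\<pi> M) * (1 - A / real q - A * (real k / real M)) * E \<le> real (\<pi> (N - k)) * E"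
        using E0 by (rule mult_right_mono)
      then show ?thesis by (simp add: algebra_simps)
    qed
    have second: "(real (\<pi> N) - real (\<pi> (N - k))) / real (\<pi> m) \<le> D / real M"
    proof -
      have "\<pi> N \<le> \<pi> (N - k) + k * (2 * (N + 1) ^ (d - 1))"
        using sph_dim_add[OF card d, of "N - k" k] NM unfolding \<pi>_def by simp
      then have "real (\<pi> N) \<le> real (\<pi> (N - k) + k * (2 * (N + 1) ^ (d - 1)))"
        by (rule of_nat_mono)
      then have "real (\<pi> N) - real (\<pi> (N - k)) \<le> real k * (2 * real (N + 1) ^ (d - 1))" by simp
      also have "\<dots> \<le> real k * B"
        unfolding B_def using NM by (intro mult_left_mono power_mono) auto
      also have "\<dots> \<le> real k * (A / real d ^ d * real M ^ (d - 1))"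
        unfolding B_def using Mpow[OF M1] by (rule mult_left_mono) simp
      finally have num: "real (\<pi> N) - real (\<pi> (N - k)) \<le> real k * (A / real d ^ d * real M ^ (d - 1))" .
      have "real M ^ d \<le> (2 * real q * real m) ^ d" using m_lower by (intro power_mono) auto
      also have "\<dots> = ((2 * real q) ^ d * real d ^ d) * (real m ^ d / real d ^ d)"
        using d by (simp add: power_mult_distrib)
      also have "\<dots> \<le> ((2 * real q) ^ d * real d ^ d) * real (\<pi> m)"
        using growth by (intro mult_left_mono) auto
      finally have den: "real M ^ d \<le> (2 * real q) ^ d * real d ^ d * real (\<pi> m)" .
      have "(real (\<pi> N) - real (\<pi> (N - k))) * real M \<le> real k * (A / real d ^ d * real M ^ (d - 1)) * real M"
        using num by (rule mult_right_mono) simp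
      also have "\<dots> = real k * A / real d ^ d * real M ^ d" by (simp add: Msplit)
      also have "\<dots> \<le> real k * A / real d ^ d * ((2 * real q) ^ d * real d ^ d * real (\<pi> m))"
        using den A0 by (intro mult_left_mono) auto
      also have "\<dots> = D * real (\<pi> m)" using d by (simp add: D_def)
      finally show ?thesis using \<pi>0[of m] M1 by (simp add: field_simps)
    qed
    have "real (\<pi> M) * (E - e) \<le> real (\<pi> M) * ((E - A * E / real q - A * E * (real k / real M)) - C * sqrt (D / real M))"
      using elim(1) qe by (intro mult_left_mono) auto
    also have "\<dots> \<le> real (\<pi> (N - k)) * E - C * real (\<pi> M) * sqrt ((real (\<pi> N) - real (\<pi> (N - k))) / real (\<pi> m))"
    proof -
      have "C * real (\<pi> M) * sqrt ((real (\<pi> N) - real (\<pi> (N - k))) / real (\<pi> m)) \<le> C * real (\<pi> M) * sqrt (D / real M)"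
        using second C0 by (intro mult_left_mono real_sqrt_le_mono) auto
      then show ?thesis using first by (simp add: algebra_simps)
    qed
    also note main
    finally show ?case using \<pi>0[of M] by (simp add: E_def field_simps)
  qed
qed


text \<open>Adding a constant to \<open>f\<close> changes both sides by that constant.\<close>

lemma fekete_average_lower_signed:
  fixes z :: "nat \<Rightarrow> nat \<Rightarrow> real ^ 'n::finite" and f :: "real ^ 'n \<Rightarrow> real"
  assumes card: "CARD('n) = d + 1" and d: "d \<ge> 1"
    and z: "\<And>L. fekete_points L (z L)" and f: "f \<in> sph_space k" and e: "e > 0"
  defines "\<pi> \<equiv> \<lambda>L. sph_dim TYPE('n) L"
  shows "eventually (\<lambda>M. sphere_mean f - e \<le> (1 / real (\<pi> M)) * (\<Sum>j<\<pi> M. f (z M j))) sequentially"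
proof -
  have fc: "continuous_on (sphere 0 1) f" using f by (rule sph_space_continuous)
  have "bounded (f ` sphere 0 1)" using fc by (intro compact_imp_bounded compact_continuous_image) auto
  then obtain C where C: "\<And>x. x \<in> sphere 0 1 \<Longrightarrow> \<bar>f x\<bar> \<le> C" unfolding bounded_iff by force
  define g where "g = f + on_sphere (\<lambda>_. C)"
  have gS: "g x = f x + C" if "x \<in> sphere 0 1" for x using that by (simp add: g_def on_sphere_def)
  have gk: "g \<in> sph_space k" unfolding g_def using f on_sphere_const by (rule sph_space_closed)
  have "sphere_mean g = sphere_mean (\<lambda>x. f x + C)"
    using gS sph_space_continuous[OF gk] by (intro sphere_mean_cong) auto
  also have "\<dots> = sphere_mean f + C" using sphere_mean_add[OF fc continuous_on_const] by (simp add: sphere_mean_const)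
  finally have mean: "sphere_mean g = sphere_mean f + C" .
  have "eventually (\<lambda>M. sphere_mean g - e \<le> (1 / real (\<pi> M)) * (\<Sum>j<\<pi> M. g (z M j))) sequentially"
    unfolding \<pi>_def
  proof (rule fekete_average_lower[OF card d z gk _ _ e])
    fix x :: "real ^ 'n" assume x: "x \<in> sphere 0 1"
    show "0 \<le> g x" "g x \<le> 2 * C" using C[OF x] gS[OF x] by auto
  qed
  then show ?thesis
  proof eventually_elim
    case (elim M)
    have zS: "z M j \<in> sphere 0 1" if "j < \<pi> M" for j
      using z[of M] that unfolding fekete_points_def \<pi>_def by blast
    have "(\<Sum>j<\<pi> M. g (z M j)) = (\<Sum>j<\<pi> M. f (z M j) + C)"
      using gS[OF zS] by (intro sum.cong) auto
    also have "\<dots> = (\<Sum>j<\<pi> M. f (z M j)) + real (\<pi> M) * C" by (simp add: sum.distrib)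
    finally show ?case using elim mean sph_dim_pos[where 'n='n and L=M]
      by (simp add: \<pi>_def distrib_left field_simps)
  qed
qed

theorem mainTheorem1:
  fixes d :: nat
    and z :: "nat \<Rightarrow> nat \<Rightarrow> real ^ 'n::finite"
    and f :: "real ^ 'n \<Rightarrow> real"
  assumes "d \<ge> 1"
    and "CARD('n) = d + 1"
    and "\<And>L. fekete_points L (z L)"
    and "continuous_on (sphere 0 1) f"
  shows "(\<lambda>L. (1 / real (sph_dim TYPE('n) L)) * (\<Sum>j<sph_dim TYPE('n) L. f (z L j)))
           \<longlonglongrightarrow> (1 / measure surface_measure (sphere (0 :: real ^ 'n) 1)) *
               (LINT x|surface_measure. f x)"
  unfolding sphere_mean_def[symmetric]
proof (rule LIMSEQ_I)
  fix r :: real assume r: "r > 0"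
  define e where "e = r / 4"
  have e: "e > 0" using r by (simp add: e_def)
  define \<mu> where "\<mu> g M = (1 / real (sph_dim TYPE('n) M)) * (\<Sum>j<sph_dim TYPE('n) M. g (z M j))"
    for g :: "real ^ 'n \<Rightarrow> real" and M
  have zS: "z M j \<in> sphere 0 1" if "j < sph_dim TYPE('n) M" for M j
    using assms(3)[of M] that unfolding fekete_points_def by blast
  obtain p where p: "real_polynomial_function p" "\<And>x. x \<in> sphere 0 1 \<Longrightarrow> \<bar>f x - p x\<bar> < e"
    using Stone_Weierstrass_real_polynomial_function[OF compact_sphere assms(4) e] by auto
  obtain k where k: "on_sphere p \<in> sph_space k" using on_sphere_polynomial[OF p(1)] by blast
  define g where "g = on_sphere p"
  have gk: "g \<in> sph_space k" using k by (simp add: g_def)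
  have fg: "\<bar>f x - g x\<bar> \<le> e" if "x \<in> sphere 0 1" for x
    using p(2)[OF that] that by (simp add: g_def on_sphere_def)
  have gc: "continuous_on (sphere 0 1) g" using gk by (rule sph_space_continuous)
  have mean: "\<bar>sphere_mean f - sphere_mean g\<bar> \<le> e"
  proof -
    have "sphere_mean f \<le> sphere_mean (\<lambda>x. g x + e)" "sphere_mean g \<le> sphere_mean (\<lambda>x. f x + e)"
      using fg by (intro sphere_mean_mono continuous_intros assms(4) gc; fastforce simp: abs_le_iff)+
    then show ?thesis
      using sphere_mean_add[OF gc continuous_on_const, of e] sphere_mean_add[OF assms(4) continuous_on_const, of e]
      by (simp add: sphere_mean_const)
  qed
  have avg: "\<bar>\<mu> f M - \<mu> g M\<bar> \<le> e" for M
  proof -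
    have "\<bar>(\<Sum>j<sph_dim TYPE('n) M. f (z M j)) - (\<Sum>j<sph_dim TYPE('n) M. g (z M j))\<bar>
        \<le> (\<Sum>j<sph_dim TYPE('n) M. e)"
      unfolding sum_subtractf[symmetric] using fg zS by (intro order_trans[OF sum_abs] sum_mono) auto
    then show ?thesis
      using sph_dim_pos[where 'n='n and L=M] unfolding \<mu>_def right_diff_distrib[symmetric] abs_mult
      by (simp add: field_simps)
  qed
  \<comment> \<open>the lower bound for \<open>- g\<close> is the upper bound for \<open>g\<close>\<close>
  have neg: "- g \<in> sph_space k" using sph_space_closed(3)[OF gk, of "-1"] by simp
  have "sphere_mean (- g) = - sphere_mean g"
    using sphere_mean_cmult[OF gc, of "-1"] by (simp add: fun_Compl_def)
  moreover have "\<mu> (- g) M = - \<mu> g M" for M by (simp add: \<mu>_def sum_negf)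
  ultimately have "eventually (\<lambda>M. - sphere_mean g - e \<le> - \<mu> g M) sequentially"
    using fekete_average_lower_signed[OF assms(2,1,3) neg e] by (simp add: \<mu>_def)
  moreover have "eventually (\<lambda>M. sphere_mean g - e \<le> \<mu> g M) sequentially"
    using fekete_average_lower_signed[OF assms(2,1,3) gk e] by (simp add: \<mu>_def)
  ultimately have "eventually (\<lambda>M. norm (\<mu> f M - sphere_mean f) < r) sequentially"
  proof eventually_elim
    case (elim M)
    then show ?case using avg[of M] mean r unfolding real_norm_def e_def by linarith
  qed
  then show "\<exists>no. \<forall>n\<ge>no. norm ((1 / real (sph_dim TYPE('n) n)) * (\<Sum>j<sph_dim TYPE('n) n. f (z n j)) - sphere_mean f) < r"
    by (simp add: eventually_sequentially \<mu>_def)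
qed

end
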